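(* Let $P$ and $Q$ be probability distributions on $\mathcal{H}$ with $\mathbb{E}_{X\sim P}[k(X,X)^2]<\infty$ and $\mathbb{E}_{Y\sim Q}[k(Y,Y)^2]<\infty$. Let $X_1,\dots,X_n$ be i.i.d. from $P$ and $Y_1,\dots,Y_m$ i.i.d. from $Q$, the two samples being independent of each other, and let $n,m\to\infty$ in such a way that $n/(n+m)\to\rho$ with $0<\rho<1$. Suppose $P\neq Q$. Then $$\sqrt{n+m}\,\bigl(\widehat{T}^2_{n,m}-T^2\bigr)\ \xrightarrow{\mathcal{D}}\ N\bigl(0,\ 4\rho^{-1}v_P^2+4(1-\rho)^{-1}v_Q^2\bigr),$$ where $T^2=\|\Sigma_k(P)-\Sigma_k(Q)\|^2_{H(k)^{\otimes 2}}$, $$v_P^2=V_{X\sim P}\Bigl[\bigl\langle \Sigma_k(P)-\Sigma_k(Q),\,(k(\cdot,X)-\mu_k(P))^{\otimes 2}-\Sigma_k(P)\bigr\rangle_{H(k)^{\otimes 2}}\Bigr]$$ and $$v_Q^2=V_{Y\sim Q}\Bigl[\bigl\langle \Sigma_k(P)-\Sigma_k(Q),\,(k(\cdot,Y)-\mu_k(Q))^{\otimes 2}-\Sigma_k(Q)\bigr\rangle_{H(k)^{\otimes 2}}\Bigr]$$ (variances of real random variables).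
   Context: $\mathcal{H}$ is a separable Hilbert space equipped with a $\sigma$-algebra $\mathcal{A}$, and $k:\mathcal{H}\times\mathcal{H}\to\mathbb{R}$ is a characteristic positive definite kernel with reproducing kernel Hilbert space $H(k)$ (characteristic: $\mu_k(P)=\mu_k(Q)$ implies $P=Q$, with $\mu_k$ as below). For $h,h'\in H(k)$, $h\otimes h'$ is the operator $x\mapsto\langle h',x\rangle_{H(k)}h$ on $H(k)$, $h^{\otimes 2}=h\otimes h$, and $H(k)^{\otimes 2}=H(k)\otimes H(k)$ is the Hilbert tensor product (Hilbert--Schmidt operators on $H(k)$ with the Hilbert--Schmidt inner product). Expectations of Hilbert-space-valued variables are Bochner integrals. For a distribution $P$: $\mu_k(P)=\mathbb{E}_{X\sim P}[k(\cdot,X)]\in H(k)$ and $\Sigma_k(P)=\mathbb{E}_{X\sim P}[(k(\cdot,X)-\mu_k(P))^{\otimes 2}]\in H(k)^{\otimes 2}$. Test statistic: $\widehat{T}^2_{n,m}=\|\Sigma_k(\widehat{P})-\Sigma_k(\widehat{Q})\|^2_{H(k)^{\otimes 2}}$, where $\mu_k(\widehat{P})=\frac1n\sum_{i=1}^n k(\cdot,X_i)$, $\Sigma_k(\widehat{P})=\frac1n\sum_{i=1}^n (k(\cdot,X_i)-\mu_k(\widehat{P}))^{\otimes 2}$, $\mu_k(\widehat{Q})=\frac1m\sum_{j=1}^m k(\cdot,Y_j)$, $\Sigma_k(\widehat{Q})=\frac1m\sum_{j=1}^m (k(\cdot,Y_j)-\mu_k(\widehat{Q}))^{\otimes 2}$.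 The symbol $\xrightarrow{\mathcal{D}}$ denotes convergence in distribution, and $N(0,0)$ is the point mass at $0$. *)

theory Defs
  imports "HOL-Probability.Probability"
begin

section \<open>Orthonormal bases of separable real Hilbert spaces\<close>

definition orthonormal :: "'h::real_inner set \<Rightarrow> bool" where
  "orthonormal E \<longleftrightarrow> (\<forall>e\<in>E. norm e = 1) \<and> pairwise orthogonal E"

definition orthonormal_basis :: "'h::real_inner set \<Rightarrow> bool" where
  "orthonormal_basis E \<longleftrightarrow> orthonormal E \<and> closure (span E) = UNIV"

lemma orthonormal_inner:
  assumes "orthonormal E" "e \<in> E" "f \<in> E"
  shows "e \<bullet> f = (if e = f then 1 else 0)"
  using assms unfolding orthonormal_def pairwise_def orthogonal_def
  by (auto simp: dot_square_norm)

lemma orthonormal_subset: "orthonormal E \<Longrightarrow> F \<subseteq> E \<Longrightarrow> orthonormal F"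
  unfolding orthonormal_def by (meson pairwise_subset subsetD)

lemma orthonormal_sum_inner:
  assumes "finite F" "orthonormal F" "f \<in> F"
  shows "(\<Sum>e\<in>F. c e *\<^sub>R e) \<bullet> f = c f"
proof -
  have "(\<Sum>e\<in>F. c e *\<^sub>R e) \<bullet> f = (\<Sum>e\<in>F. if e = f then c e else 0)"
    unfolding inner_sum_left inner_scaleR_left
    by (rule sum.cong) (auto simp: orthonormal_inner[OF assms(2) _ assms(3)])
  then show ?thesis using assms by simp
qed

lemma orthonormal_sum_norm:
  assumes "finite F" "orthonormal F"
  shows "(norm (\<Sum>e\<in>F. c e *\<^sub>R e))\<^sup>2 = (\<Sum>e\<in>F. (c e)\<^sup>2)"
proof -
  have "(norm (\<Sum>e\<in>F. c e *\<^sub>R e))\<^sup>2 = (\<Sum>e\<in>F. c e *\<^sub>R e) \<bullet> (\<Sum>e\<in>F. c e *\<^sub>R e)"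
    by (simp add: power2_norm_eq_inner)
  also have "\<dots> = (\<Sum>f\<in>F. c f * ((\<Sum>e\<in>F. c e *\<^sub>R e) \<bullet> f))"
    by (subst inner_sum_right) simp
  also have "\<dots> = (\<Sum>f\<in>F. (c f)\<^sup>2)"
    by (rule sum.cong) (simp_all add: orthonormal_sum_inner[OF assms] power2_eq_square)
  finally show ?thesis .
qed

lemma bessel_finite:
  assumes "finite F" "orthonormal F"
  shows "(\<Sum>e\<in>F. (x \<bullet> e)\<^sup>2) \<le> (norm x)\<^sup>2"
proof -
  let ?p = "\<Sum>e\<in>F. (x \<bullet> e) *\<^sub>R e"
  have "x \<bullet> ?p = (\<Sum>e\<in>F. (x \<bullet> e)\<^sup>2)"
    by (simp add: inner_sum_right power2_eq_square)
  moreover have "?p \<bullet> ?p = (\<Sum>e\<in>F. (x \<bullet> e)\<^sup>2)"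
    using orthonormal_sum_norm[OF assms] by (simp add: power2_norm_eq_inner)
  moreover have "0 \<le> (x - ?p) \<bullet> (x - ?p)" by simp
  ultimately show ?thesis
    by (simp add: inner_diff_left inner_diff_right inner_commute power2_norm_eq_inner)
qed

lemma bessel_summable:
  assumes "orthonormal E"
  shows "(\<lambda>e. (x \<bullet> e)\<^sup>2) summable_on E"
proof (rule nonneg_bdd_above_summable_on)
  show "bdd_above (sum (\<lambda>e. (x \<bullet> e)\<^sup>2) ` {F. F \<subseteq> E \<and> finite F})"
    using bessel_finite orthonormal_subset[OF assms] by (intro bdd_aboveI2[of _ _ "(norm x)\<^sup>2"]) auto
qed simp

lemma orthonormal_extend:
  assumes "finite F" "orthonormal F"
  obtains F' where "finite F'" "orthonormal F'" "F \<subseteq> F'" "d \<in> span F'"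
proof (cases "d \<in> span F")
  case True
  then show ?thesis using assms that by blast
next
  case False
  let ?p = "\<Sum>e\<in>F. (d \<bullet> e) *\<^sub>R e"
  define g where "g = d - ?p"
  define u where "u = g /\<^sub>R norm g"
  have p: "?p \<in> span F" by (intro span_sum span_scale span_base)
  have g0: "g \<noteq> 0" using False p unfolding g_def by auto
  have ge: "g \<bullet> e = 0" if "e \<in> F" for e
    unfolding g_def by (simp add: inner_diff_left orthonormal_sum_inner[OF assms that])
  have "norm u = 1" using g0 by (simp add: u_def)
  moreover have "u \<bullet> e = 0" "e \<bullet> u = 0" if "e \<in> F" for e
    using ge[OF that] by (simp_all add: u_def inner_commute)
  ultimately have "orthonormal (insert u F)"
    using assms(2) unfolding orthonormal_def pairwise_insert orthogonal_def by auto
  moreover have "d = norm g *\<^sub>R u + ?p" using g0 by (simp add: u_def g_def)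
  then have "d \<in> span (insert u F)"
    using p span_mono[of F "insert u F"]
    by (metis insertI1 span_add span_base span_scale subset_insertI subsetD)
  ultimately show ?thesis using assms(1) that[of "insert u F"] by auto
qed

lemma orthonormal_basis_exists:
  "\<exists>E. orthonormal_basis (E :: 'h::{real_inner, second_countable_topology} set)"
proof -
  obtain D :: "'h set" where D: "countable D" "\<And>X. open X \<Longrightarrow> X \<noteq> {} \<Longrightarrow> \<exists>d\<in>D. d \<in> X"
    using countable_dense_setE by blast
  have "D \<noteq> {}" using D(2)[of UNIV] by auto
  define d where "d = from_nat_into D"
  have rd: "range d = D" using D(1) \<open>D \<noteq> {}\<close> by (simp add: d_def)
  have "\<exists>F :: nat \<Rightarrow> 'h set. \<forall>n. (finite (F n) \<and> orthonormal (F n)) \<and> (F n \<subseteq> F (Suc n) \<and> d n \<in> span (F (Suc n)))"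
  proof (rule dependent_nat_choice)
    show "\<exists>F :: 'h set. finite F \<and> orthonormal F"
      by (rule exI[of _ "{}"]) (simp add: orthonormal_def)
    fix F :: "'h set" and n assume "finite F \<and> orthonormal F"
    then obtain F' where "finite F'" "orthonormal F'" "F \<subseteq> F'" "d n \<in> span F'"
      using orthonormal_extend by blast
    then show "\<exists>G. (finite G \<and> orthonormal G) \<and> F \<subseteq> G \<and> d n \<in> span G" by blast
  qed
  then obtain F :: "nat \<Rightarrow> 'h set" where F: "\<And>n. orthonormal (F n)" "\<And>n. F n \<subseteq> F (Suc n)"
    "\<And>n. d n \<in> span (F (Suc n))"
    by blast
  have mono: "F m \<subseteq> F n" if "m \<le> n" for m n
    using lift_Suc_mono_le[of F, OF F(2) that] .
  have "orthonormal (\<Union>(range F))"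
    unfolding orthonormal_def pairwise_def
  proof (intro conjI ballI impI)
    fix e assume "e \<in> \<Union>(range F)"
    then show "norm e = 1" using F(1) unfolding orthonormal_def by blast
  next
    fix e f assume "e \<in> \<Union>(range F)" "f \<in> \<Union>(range F)" and ne: "e \<noteq> f"
    then obtain m n where "e \<in> F m" "f \<in> F n" by blast
    then have "e \<in> F (max m n)" "f \<in> F (max m n)"
      using mono[of m "max m n"] mono[of n "max m n"] by auto
    then show "orthogonal e f"
      using orthonormal_inner[OF F(1)] ne unfolding orthogonal_def by auto
  qed
  moreover have "closure (span (\<Union>(range F))) = UNIV"
  proof -
    have "D \<subseteq> span (\<Union>(range F))"
    proof
      fix x assume "x \<in> D"
      then obtain n where "x = d n" using rd by auto
      then show "x \<in> span (\<Union>(range F))"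
        using F(3)[of n] span_mono[of "F (Suc n)" "\<Union>(range F)"] by auto
    qed
    moreover have "closure D = UNIV"
      using D(2) unfolding closure_iff_nhds_not_empty set_eq_iff by blast
    ultimately show ?thesis using closure_mono by (metis top.extremum_uniqueI)
  qed
  ultimately show ?thesis unfolding orthonormal_basis_def by blast
qed

lemma orthonormal_countable:
  fixes E :: "'h::{real_inner, second_countable_topology} set"
  assumes "orthonormal E"
  shows "countable E"
proof -
  have far: "1 < dist e f" if "e \<in> E" "f \<in> E" "e \<noteq> f" for e f
  proof -
    have "(dist e f)\<^sup>2 = 2"
      using orthonormal_inner[OF assms that(1,2)] orthonormal_inner[OF assms that(1,1)]
        orthonormal_inner[OF assms that(2,2)] orthonormal_inner[OF assms that(2,1)] that(3)
      by (simp add: dist_norm power2_norm_eq_inner inner_diff_left inner_diff_right)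
    then have "1\<^sup>2 < (dist e f)\<^sup>2" by simp
    then show ?thesis by (rule power_less_imp_less_base) simp
  qed
  have "disjoint ((\<lambda>e. ball e (1/2)) ` E)"
  proof (rule pairwise_imageI)
    fix e f assume "e \<in> E" "f \<in> E" "e \<noteq> f"
    then show "disjnt (ball e (1/2)) (ball f (1/2))"
      using far[of e f] unfolding disjnt_def
      by (auto simp: disjoint_iff) (smt (verit) dist_commute dist_triangle field_sum_of_halves)
  qed
  then have "countable ((\<lambda>e. ball e (1/2)) ` E)"
    by (intro countable_disjoint_open_subsets) auto
  moreover have "inj_on (\<lambda>e. ball e (1/2)) E"
  proof (rule inj_onI, rule ccontr)
    fix e f assume *: "e \<in> E" "f \<in> E" "ball e (1/2) = ball f (1/2)" "e \<noteq> f"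
    then have "e \<in> ball f (1/2)" by (metis centre_in_ball half_gt_zero zero_less_one)
    then show False using far[OF *(1,2,4)] by (simp add: dist_commute)
  qed
  ultimately show ?thesis by (rule countable_image_inj_on)
qed

text \<open>A fixed orthonormal basis. Neither the Hilbert--Schmidt property nor the
  Hilbert--Schmidt inner product depends on which basis is chosen.\<close>

definition onb :: "'h::real_inner set" where
  "onb = (SOME E. orthonormal_basis E)"

lemma onb: "orthonormal_basis (onb :: 'h::{real_inner, second_countable_topology} set)"
  unfolding onb_def using orthonormal_basis_exists by (rule someI_ex)

lemma orthonormal_onb: "orthonormal (onb :: 'h::{real_inner, second_countable_topology} set)"
  using onb unfolding orthonormal_basis_def by blast

lemma closure_span_onb: "closure (span (onb :: 'h::{real_inner, second_countable_topology} set)) = UNIV"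
  using onb unfolding orthonormal_basis_def by blast


section \<open>The Hilbert space of Hilbert--Schmidt operators\<close>

definition hilbert_schmidt :: "('h::real_inner \<Rightarrow>\<^sub>L 'h) \<Rightarrow> bool" where
  "hilbert_schmidt A \<longleftrightarrow> (\<lambda>e. (norm (A e))\<^sup>2) summable_on onb"

lemma hilbert_schmidt_zero: "hilbert_schmidt 0"
  by (simp add: hilbert_schmidt_def)

lemma hilbert_schmidt_scaleR: "hilbert_schmidt A \<Longrightarrow> hilbert_schmidt (c *\<^sub>R A)"
  unfolding hilbert_schmidt_def
  by (simp add: scaleR_blinfun.rep_eq power_mult_distrib summable_on_cmult_right)

lemma hilbert_schmidt_add:
  assumes "hilbert_schmidt A" "hilbert_schmidt B"
  shows "hilbert_schmidt (A + B)"
  unfolding hilbert_schmidt_def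
proof (rule summable_on_comparison_test)
  show "(\<lambda>e. 2 * ((norm (A e))\<^sup>2 + (norm (B e))\<^sup>2)) summable_on onb"
    using assms unfolding hilbert_schmidt_def by (intro summable_on_cmult_right summable_on_add)
  fix e
  have "(norm ((A + B) e))\<^sup>2 \<le> (norm (A e) + norm (B e))\<^sup>2"
    unfolding plus_blinfun.rep_eq by (intro power_mono norm_triangle_ineq) simp
  also have "\<dots> \<le> 2 * ((norm (A e))\<^sup>2 + (norm (B e))\<^sup>2)"
    using sum_squares_ge_zero[of "norm (A e) - norm (B e)" 0] by (simp add: power2_eq_square algebra_simps)
  finally show "(norm ((A + B) e))\<^sup>2 \<le> 2 * ((norm (A e))\<^sup>2 + (norm (B e))\<^sup>2)" .
qed simp

lemma hilbert_schmidt_uminus: "hilbert_schmidt A \<Longrightarrow> hilbert_schmidt (- A)"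
  using hilbert_schmidt_scaleR[of A "-1"] by simp

lemma hilbert_schmidt_diff: "hilbert_schmidt A \<Longrightarrow> hilbert_schmidt B \<Longrightarrow> hilbert_schmidt (A - B)"
  using hilbert_schmidt_add[of A "- B"] hilbert_schmidt_uminus[of B] by simp

lemma hilbert_schmidt_inner_summable:
  assumes "hilbert_schmidt A" "hilbert_schmidt B"
  shows "(\<lambda>e. A e \<bullet> B e) summable_on onb"
proof (rule abs_summable_summable, rule summable_on_comparison_test)
  show "(\<lambda>e. (norm (A e))\<^sup>2 + (norm (B e))\<^sup>2) summable_on onb"
    using assms unfolding hilbert_schmidt_def by (intro summable_on_add)
  fix e
  have "\<bar>A e \<bullet> B e\<bar> \<le> norm (A e) * norm (B e)" by (rule Cauchy_Schwarz_ineq2)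
  also have "\<dots> \<le> (norm (A e))\<^sup>2 + (norm (B e))\<^sup>2"
    using zero_le_power2[of "norm (A e) - norm (B e)"] zero_le_power2[of "norm (A e)"]
      zero_le_power2[of "norm (B e)"] unfolding power2_diff by linarith
  finally show "norm (A e \<bullet> B e) \<le> (norm (A e))\<^sup>2 + (norm (B e))\<^sup>2" by simp
qed simp

lemma hilbert_schmidt_bound:
  fixes A :: "'h::{real_inner, second_countable_topology} \<Rightarrow>\<^sub>L 'h"
  assumes "hilbert_schmidt A"
  shows "norm A \<le> sqrt (\<Sum>\<^sub>\<infinity>e\<in>onb. (norm (A e))\<^sup>2)" (is "_ \<le> ?C")
proof (rule norm_blinfun_bound)
  show "0 \<le> ?C" by (intro real_sqrt_ge_zero infsum_nonneg) simp
  have on_span: "norm (A x) \<le> ?C * norm x" if x: "x \<in> span onb" for x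
  proof -
    obtain t r where t: "finite t" "t \<subseteq> onb" "x = (\<Sum>a\<in>t. r a *\<^sub>R a)"
      using x unfolding span_explicit by auto
    have ot: "orthonormal t" using orthonormal_onb t(2) by (rule orthonormal_subset)
    have "norm (A x) = norm (\<Sum>a\<in>t. r a *\<^sub>R A a)"
      unfolding t(3) by (simp add: blinfun.sum_right blinfun.scaleR_right)
    also have "\<dots> \<le> (\<Sum>a\<in>t. \<bar>norm (A a)\<bar> * \<bar>r a\<bar>)"
      by (rule order_trans[OF norm_sum]) (simp add: mult.commute)
    also have "\<dots> \<le> L2_set (\<lambda>a. norm (A a)) t * L2_set r t"
      by (rule L2_set_mult_ineq)
    also have "L2_set r t = norm x"
      unfolding L2_set_def t(3) orthonormal_sum_norm[OF t(1) ot, symmetric] by simp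
    also have "L2_set (\<lambda>a. norm (A a)) t \<le> ?C"
      unfolding L2_set_def
      using assms t unfolding hilbert_schmidt_def
      by (intro real_sqrt_le_mono finite_sum_le_infsum) auto
    finally show ?thesis by (simp add: mult_right_mono)
  qed
  fix x
  have "closed {x. norm (A x) \<le> ?C * norm x}"
    by (intro closed_Collect_le continuous_intros)
  then have "closure (span onb) \<subseteq> {x. norm (A x) \<le> ?C * norm x}"
    using on_span by (intro closure_minimal) auto
  then show "norm (A x) \<le> ?C * norm x" unfolding closure_span_onb by blast
qed

typedef (overloaded) ('h::"{real_inner, banach, second_countable_topology}") hs =
  "{A :: 'h \<Rightarrow>\<^sub>L 'h. hilbert_schmidt A}"
  morphisms hs_op Abs_hs
  using hilbert_schmidt_zero by blast

setup_lifting type_definition_hs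

instantiation hs :: ("{real_inner, banach, second_countable_topology}") real_vector
begin

lift_definition zero_hs :: "'a hs" is 0 by (rule hilbert_schmidt_zero)
lift_definition plus_hs :: "'a hs \<Rightarrow> 'a hs \<Rightarrow> 'a hs" is "(+)" by (rule hilbert_schmidt_add)
lift_definition uminus_hs :: "'a hs \<Rightarrow> 'a hs" is uminus by (rule hilbert_schmidt_uminus)
lift_definition minus_hs :: "'a hs \<Rightarrow> 'a hs \<Rightarrow> 'a hs" is "(-)" by (rule hilbert_schmidt_diff)
lift_definition scaleR_hs :: "real \<Rightarrow> 'a hs \<Rightarrow> 'a hs" is "(*\<^sub>R)" by (rule hilbert_schmidt_scaleR)
instance
  by standard (transfer; simp add: algebra_simps)+

end

instantiation hs :: ("{real_inner, banach, second_countable_topology}") real_inner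
begin

lift_definition inner_hs :: "'a hs \<Rightarrow> 'a hs \<Rightarrow> real" is "\<lambda>(A :: 'a \<Rightarrow>\<^sub>L 'a) (B :: 'a \<Rightarrow>\<^sub>L 'a). \<Sum>\<^sub>\<infinity>e\<in>onb. A e \<bullet> B e" .
definition norm_hs :: "'a hs \<Rightarrow> real" where "norm_hs A = sqrt (A \<bullet> A)"
definition dist_hs :: "'a hs \<Rightarrow> 'a hs \<Rightarrow> real" where "dist_hs A B = norm (A - B)"
definition sgn_hs :: "'a hs \<Rightarrow> 'a hs" where "sgn_hs A = A /\<^sub>R norm A"
definition uniformity_hs :: "('a hs \<times> 'a hs) filter" where
  "uniformity_hs = (INF e\<in>{0<..}. principal {(A, B). dist A B < e})"
definition open_hs :: "'a hs set \<Rightarrow> bool" where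
  "open_hs U \<longleftrightarrow> (\<forall>A\<in>U. eventually (\<lambda>(A', B). A' = A \<longrightarrow> B \<in> U) uniformity)"

instance
proof
  fix A B C :: "'a hs" and r :: real
  show "dist A B = norm (A - B)" "sgn A = A /\<^sub>R norm A" "norm A = sqrt (A \<bullet> A)"
    by (rule dist_hs_def sgn_hs_def norm_hs_def)+
  show "(uniformity :: ('a hs \<times> 'a hs) filter) = (INF e\<in>{0<..}. principal {(A, B). dist A B < e})"
    by (rule uniformity_hs_def)
  show "open U \<longleftrightarrow> (\<forall>A\<in>U. eventually (\<lambda>(A', B). A' = A \<longrightarrow> B \<in> U) uniformity)" for U :: "'a hs set"
    by (rule open_hs_def)
  show "A \<bullet> B = B \<bullet> A" by transfer (simp add: inner_commute)
  show "(A + B) \<bullet> C = A \<bullet> C + B \<bullet> C"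
    by transfer (simp add: plus_blinfun.rep_eq inner_add_left infsum_add hilbert_schmidt_inner_summable)
  show "(r *\<^sub>R A) \<bullet> B = r * (A \<bullet> B)"
    by transfer (simp add: scaleR_blinfun.rep_eq infsum_cmult_right')
  show "0 \<le> A \<bullet> A" by transfer (simp add: infsum_nonneg)
  show "A \<bullet> A = 0 \<longleftrightarrow> A = 0"
  proof transfer
    fix A :: "'a \<Rightarrow>\<^sub>L 'a" assume "hilbert_schmidt A"
    from hilbert_schmidt_bound[OF this]
    show "(\<Sum>\<^sub>\<infinity>e\<in>onb. A e \<bullet> A e) = 0 \<longleftrightarrow> A = 0"
      by (auto simp: power2_norm_eq_inner)
  qed
qed

end

lemma hs_op_minus: "hs_op (A - B) = hs_op A - hs_op B"
  by (rule minus_hs.rep_eq)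

lemma norm_hs_square: "(norm A)\<^sup>2 = (\<Sum>\<^sub>\<infinity>e\<in>onb. (norm (hs_op A e))\<^sup>2)"
  unfolding power2_norm_eq_inner inner_hs.rep_eq ..

lemma hs_op_summable: "(\<lambda>e. (norm (hs_op A e))\<^sup>2) summable_on onb"
  using hs_op[of A] unfolding hilbert_schmidt_def by simp

lemma norm_hs_op_le: "norm (hs_op A) \<le> norm A"
  using hilbert_schmidt_bound[of "hs_op A"] hs_op[of A]
  by (simp add: norm_hs_square[symmetric])

lemma hs_finite_sum_le: "finite F \<Longrightarrow> F \<subseteq> onb \<Longrightarrow> (\<Sum>e\<in>F. (norm (hs_op A e))\<^sup>2) \<le> (norm A)\<^sup>2"
  unfolding norm_hs_square by (intro finite_sum_le_infsum hs_op_summable) auto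

instance hs :: ("{real_inner, banach, second_countable_topology}") banach
proof
  fix A :: "nat \<Rightarrow> 'a hs" assume C: "Cauchy A"
  have "Cauchy (\<lambda>n. hs_op (A n))"
  proof (rule CauchyI)
    fix e :: real assume "0 < e"
    with C obtain N where N: "\<And>m n. m \<ge> N \<Longrightarrow> n \<ge> N \<Longrightarrow> norm (A m - A n) < e"
      using CauchyD by blast
    then show "\<exists>N. \<forall>m\<ge>N. \<forall>n\<ge>N. norm (hs_op (A m) - hs_op (A n)) < e"
      unfolding hs_op_minus[symmetric] by (meson norm_hs_op_le order_le_less_trans)
  qed
  then have "convergent (\<lambda>n. hs_op (A n))" by (rule Cauchy_convergent)
  then obtain L where L: "(\<lambda>n. hs_op (A n)) \<longlonglongrightarrow> L"
    unfolding convergent_def ..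
  have bound: "(\<Sum>e\<in>F. (norm ((L - hs_op (A n)) e))\<^sup>2) \<le> r\<^sup>2"
    if F: "finite F" "F \<subseteq> onb" and r: "\<And>m. m \<ge> N \<Longrightarrow> norm (A m - A n) \<le> r" for F n N r
  proof (rule tendsto_upperbound)
    show "(\<lambda>m. \<Sum>e\<in>F. (norm ((hs_op (A m) - hs_op (A n)) e))\<^sup>2) \<longlonglongrightarrow> (\<Sum>e\<in>F. (norm ((L - hs_op (A n)) e))\<^sup>2)"
      by (intro tendsto_intros L)
    show "\<forall>\<^sub>F m in sequentially. (\<Sum>e\<in>F. (norm ((hs_op (A m) - hs_op (A n)) e))\<^sup>2) \<le> r\<^sup>2"
      unfolding eventually_sequentially hs_op_minus[symmetric]
      using hs_finite_sum_le[OF F] r by (meson norm_ge_zero order_trans power_mono)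
  qed simp
  have hs_diff: "hilbert_schmidt (L - hs_op (A n))"
    if r: "\<And>m. m \<ge> N \<Longrightarrow> norm (A m - A n) \<le> r" for n N r
    unfolding hilbert_schmidt_def
    by (rule nonneg_bdd_above_summable_on)
      (auto intro!: bdd_aboveI2[of _ _ "r\<^sup>2"] bound[OF _ _ r])
  obtain N0 where "\<And>m n. m \<ge> N0 \<Longrightarrow> n \<ge> N0 \<Longrightarrow> norm (A m - A n) < 1"
    using CauchyD[OF C, of 1] by auto
  then have "hilbert_schmidt (L - hs_op (A N0))" using hs_diff[of N0 N0 1] by (simp add: less_imp_le)
  then have hsL: "hilbert_schmidt L"
    using hilbert_schmidt_add[of "L - hs_op (A N0)" "hs_op (A N0)"] hs_op[of "A N0"] by simp
  have opL: "hs_op (Abs_hs L) = L" using hsL by (simp add: Abs_hs_inverse)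
  have "A \<longlonglongrightarrow> Abs_hs L"
  proof (rule LIMSEQ_I)
    fix e :: real assume e: "0 < e"
    then obtain N where N: "\<And>m n. m \<ge> N \<Longrightarrow> n \<ge> N \<Longrightarrow> norm (A m - A n) < e/2"
      using CauchyD[OF C, of "e/2"] by auto
    have "norm (A n - Abs_hs L) < e" if n: "n \<ge> N" for n
    proof -
      have "(norm (Abs_hs L - A n))\<^sup>2 \<le> (e/2)\<^sup>2"
        unfolding norm_hs_square
        by (rule infsum_le_finite_sums[OF hs_op_summable])
          (auto simp: hs_op_minus opL intro!: bound[of _ N] less_imp_le[OF N] n)
      then have "norm (Abs_hs L - A n) \<le> e/2"
        by (rule power2_le_imp_le) (use e in simp)
      then show ?thesis using e by (simp add: norm_minus_commute)
    qed
    then show "\<exists>N. \<forall>n\<ge>N. norm (A n - Abs_hs L) < e" by blast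
  qed
  then show "convergent A" unfolding convergent_def by blast
qed

lift_definition tensor :: "'h \<Rightarrow> 'h \<Rightarrow> 'h::{real_inner, banach, second_countable_topology} hs"
    (infixr "\<otimes>\<^sub>h" 75)
  is "\<lambda>h h'. blinfun_scaleR_left h o\<^sub>L blinfun_inner_right h'"
proof -
  fix h h' :: 'h
  show "hilbert_schmidt (blinfun_scaleR_left h o\<^sub>L blinfun_inner_right h')"
    unfolding hilbert_schmidt_def
    by (simp add: power_mult_distrib summable_on_cmult_left bessel_summable[OF orthonormal_onb])
qed

lemma tensor_apply: "hs_op (h \<otimes>\<^sub>h h') x = (h' \<bullet> x) *\<^sub>R h"
  by transfer simp

lemma separable_imp_countable_basis:
  fixes C :: "'b::metric_space set"
  assumes C: "countable C" and dense: "\<And>x e. 0 < e \<Longrightarrow> \<exists>c\<in>C. dist c x < e"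
  shows "\<exists>B :: 'b set set. countable B \<and> open = generate_topology B"
proof -
  define B where "B = (\<lambda>(c, n). ball c (inverse (Suc n))) ` (C \<times> (UNIV :: nat set))"
  have "topological_basis B"
  proof (rule topological_basisI)
    fix b assume "b \<in> B" then show "open b" unfolding B_def by auto
  next
    fix U and x :: 'b assume "open U" "x \<in> U"
    then obtain e where e: "0 < e" "ball x e \<subseteq> U" unfolding open_contains_ball by blast
    obtain n where n: "inverse (Suc n) < e / 2" using reals_Archimedean[of "e/2"] e by auto
    obtain c where c: "c \<in> C" "dist c x < inverse (Suc n)"
      using dense[of "inverse (Suc n)" x] by auto
    have "ball c (inverse (Suc n)) \<subseteq> ball x e"
    proof
      fix y assume "y \<in> ball c (inverse (Suc n))"
      then have "dist c y < inverse (Suc n)" by simp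
      moreover have "dist x y \<le> dist c x + dist c y" by (metis dist_commute dist_triangle)
      ultimately show "y \<in> ball x e" using c n by simp
    qed
    then show "\<exists>B'\<in>B. x \<in> B' \<and> B' \<subseteq> U"
      using c e unfolding B_def by (intro bexI[of _ "ball c (inverse (Suc n))"]) auto
  qed
  moreover have "countable B" unfolding B_def using C by auto
  ultimately show ?thesis using topological_basis_imp_subbasis by blast
qed

lemma hs_op_sum: "hs_op (\<Sum>a\<in>F. g a) = (\<Sum>a\<in>F. hs_op (g a))"
  by (induction F rule: infinite_finite_induct) (simp_all add: zero_hs.rep_eq plus_hs.rep_eq)

instance hs :: ("{real_inner, banach, second_countable_topology}") second_countable_topology
proof
  obtain D :: "'a set" where D: "countable D" "\<And>X. open X \<Longrightarrow> X \<noteq> {} \<Longrightarrow> \<exists>d\<in>D. d \<in> X"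
    using countable_dense_setE by blast
  define C :: "'a hs set" where
    "C = (\<lambda>S. \<Sum>p\<in>S. fst p \<otimes>\<^sub>h snd p) ` {S. finite S \<and> S \<subseteq> D \<times> onb}"
  have "countable (D \<times> (onb :: 'a set))"
    using D(1) orthonormal_countable[OF orthonormal_onb] by (rule countable_SIGMA)
  then have "countable {S. finite S \<and> S \<subseteq> D \<times> (onb :: 'a set)}"
    by (rule countable_Collect_finite_subset)
  then have "countable C" unfolding C_def by (rule countable_image)
  moreover have "\<exists>c\<in>C. dist c A < e" if e: "0 < e" for A :: "'a hs" and e
  proof -
    define f where "f = (\<lambda>a. (norm (hs_op A a))\<^sup>2)"
    have f: "f summable_on onb" unfolding f_def by (rule hs_op_summable)
    obtain F where F: "finite F" "F \<subseteq> onb" "dist (sum f F) (infsum f onb) \<le> e\<^sup>2 / 4"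
      using has_sum_finite_approximation[OF has_sum_infsum[OF f], of "e\<^sup>2 / 4"] e by auto
    define \<delta> where "\<delta> = sqrt (e\<^sup>2 / (4 * (card F + 1)))"
    have \<delta>: "0 < \<delta>" "\<delta>\<^sup>2 = e\<^sup>2 / (4 * (card F + 1))" using e by (simp_all add: \<delta>_def)
    have "\<exists>d\<in>D. dist (hs_op A a) d < \<delta>" for a
      using D(2)[of "ball (hs_op A a) \<delta>"] \<delta>(1) by auto
    then obtain g where g: "\<And>a. g a \<in> D" "\<And>a. dist (hs_op A a) (g a) < \<delta>" by metis
    define B where "B = (\<Sum>a\<in>F. g a \<otimes>\<^sub>h a)"
    have "B = (\<Sum>p\<in>(\<lambda>a. (g a, a)) ` F. fst p \<otimes>\<^sub>h snd p)"
      unfolding B_def by (subst sum.reindex) (auto simp: inj_on_def)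
    then have "B \<in> C" unfolding C_def using F g by blast
    have Ba: "hs_op B a = (if a \<in> F then g a else 0)" if a: "a \<in> onb" for a
    proof -
      have "hs_op B a = (\<Sum>b\<in>F. (b \<bullet> a) *\<^sub>R g b)"
        unfolding B_def hs_op_sum blinfun.sum_left tensor_apply ..
      also have "\<dots> = (\<Sum>b\<in>F. if b = a then g b else 0)"
        using F(2) by (intro sum.cong refl) (auto simp: orthonormal_inner[OF orthonormal_onb _ a])
      finally show ?thesis using F(1) by simp
    qed
    define h where "h = (\<lambda>a. (norm (hs_op (A - B) a))\<^sup>2)"
    have hF: "h a \<le> \<delta>\<^sup>2" if "a \<in> F" for a
    proof -
      have "norm (hs_op (A - B) a) \<le> \<delta>"
        using g(2)[of a] F(2) that Ba[of a]
        by (auto simp: hs_op_minus minus_blinfun.rep_eq dist_norm)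
      then show ?thesis unfolding h_def by (intro power_mono) auto
    qed
    have hN: "h a = f a" if "a \<in> onb" "a \<notin> F" for a
      using Ba[of a] that by (simp add: h_def f_def hs_op_minus minus_blinfun.rep_eq)
    have sumF: "sum h F \<le> e\<^sup>2 / 4"
    proof -
      have "sum h F \<le> card F * \<delta>\<^sup>2" using hF by (rule sum_bounded_above)
      also have "\<dots> \<le> e\<^sup>2 / 4" unfolding \<delta>(2) by (simp add: field_simps)
      finally show ?thesis .
    qed
    have "(norm (A - B))\<^sup>2 \<le> e\<^sup>2 / 2"
      unfolding norm_hs_square
    proof (rule infsum_le_finite_sums[OF hs_op_summable])
      fix G :: "'a set" assume G: "finite G" "G \<subseteq> onb"
      have "sum h G \<le> sum h (F \<union> (G - F))"
        using F G by (intro sum_mono2) (auto simp: h_def)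
      also have "\<dots> = sum h F + sum h (G - F)" using F G by (intro sum.union_disjoint) auto
      also have "sum h (G - F) = sum f (G - F)" using G hN by (intro sum.cong) auto
      also have "sum f (G - F) = sum f (F \<union> (G - F)) - sum f F"
        using F G by (subst sum.union_disjoint) auto
      also have "sum f (F \<union> (G - F)) \<le> infsum f onb"
        using F G by (intro finite_sum_le_infsum f) (auto simp: f_def)
      finally have "sum h G \<le> sum h F + (infsum f onb - sum f F)" by simp
      also have "\<dots> \<le> e\<^sup>2 / 2" using sumF F(3) unfolding dist_real_def by linarith
      finally show "(\<Sum>a\<in>G. (norm (hs_op (A - B) a))\<^sup>2) \<le> e\<^sup>2 / 2" unfolding h_def .
    qed
    also have "\<dots> < e\<^sup>2" using e by simp
    finally have "norm (A - B) < e" by (rule power_less_imp_less_base) (use e in simp)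
    then show ?thesis using \<open>B \<in> C\<close> by (auto simp: dist_norm norm_minus_commute)
  qed
  ultimately show "\<exists>B :: 'a hs set set. countable B \<and> open = generate_topology B"
    by (rule separable_imp_countable_basis)
qed

abbreviation tensor_square :: "'h \<Rightarrow> 'h::{real_inner, banach, second_countable_topology} hs" where
  "tensor_square h \<equiv> h \<otimes>\<^sub>h h"


section \<open>Reproducing kernel Hilbert spaces\<close>

definition pd_kernel :: "('a \<Rightarrow> 'a \<Rightarrow> real) \<Rightarrow> bool" where
  "pd_kernel k \<longleftrightarrow> (\<forall>x y. k x y = k y x) \<and>
     (\<forall>F c. finite F \<longrightarrow> 0 \<le> (\<Sum>x\<in>F. \<Sum>y\<in>F. c x * c y * k x y))"

text \<open>The reproducing kernel Hilbert space of \<open>k\<close> is a space of functions that depends on the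
  value \<open>k\<close>, so it cannot be a type. It is rendered as a Hilbert space type \<open>'h\<close> together with the
  map \<open>fn\<close> sending an element of \<open>'h\<close> to the function it denotes; the predicate below says that,
  under the identification \<open>fn\<close>, the type \<open>'h\<close> is a Hilbert space of functions with
  reproducing kernel \<open>k\<close>.\<close>

definition is_rkhs :: "('a \<Rightarrow> 'a \<Rightarrow> real) \<Rightarrow> ('h::{real_inner, banach} \<Rightarrow> 'a \<Rightarrow> real) \<Rightarrow> bool" where
  "is_rkhs k fn \<longleftrightarrow>
     inj fn \<and>
     (\<forall>f g. fn (f + g) = (\<lambda>x. fn f x + fn g x)) \<and>
     (\<forall>c f. fn (c *\<^sub>R f) = (\<lambda>x. c * fn f x)) \<and>
     (\<forall>x. \<exists>h. fn h = (\<lambda>y. k y x) \<and> (\<forall>f. f \<bullet> h = fn f x))"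

definition kernel_section :: "('a \<Rightarrow> 'a \<Rightarrow> real) \<Rightarrow> ('h \<Rightarrow> 'a \<Rightarrow> real) \<Rightarrow> 'a \<Rightarrow> 'h" where
  "kernel_section k fn x = inv fn (\<lambda>y. k y x)"

text \<open>Bochner integrals are the library's, which ask for a second countable target. For \<open>'h\<close> this
  is no restriction beyond Bochner measurability of \<open>x \<mapsto> k(\<cdot>, x)\<close>: a Bochner measurable map has
  separable range, and an RKHS is the closed span of its kernel sections. For \<open>'h hs\<close> it is
  proved above.\<close>

definition kernel_mean ::
    "('a \<Rightarrow> 'a \<Rightarrow> real) \<Rightarrow> ('h::{real_inner, banach, second_countable_topology} \<Rightarrow> 'a \<Rightarrow> real)
      \<Rightarrow> 'a measure \<Rightarrow> 'h" where
  "kernel_mean k fn P = (\<integral>x. kernel_section k fn x \<partial>P)"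

text \<open>The library's integral is \<open>0\<close> for non-integrable functions, so injectivity of the mean
  embedding is required only among the distributions whose embedding exists.\<close>

definition characteristic_kernel ::
    "'a measure \<Rightarrow> ('a \<Rightarrow> 'a \<Rightarrow> real)
      \<Rightarrow> ('h::{real_inner, banach, second_countable_topology} \<Rightarrow> 'a \<Rightarrow> real) \<Rightarrow> bool" where
  "characteristic_kernel A k fn \<longleftrightarrow>
     (\<forall>P Q. prob_space P \<and> sets P = sets A \<and> integrable P (kernel_section k fn) \<and>
            prob_space Q \<and> sets Q = sets A \<and> integrable Q (kernel_section k fn) \<and>
            kernel_mean k fn P = kernel_mean k fn Q \<longrightarrow> P = Q)"

definition kernel_cov ::
    "('a \<Rightarrow> 'a \<Rightarrow> real) \<Rightarrow> ('h::{real_inner, banach, second_countable_topology} \<Rightarrow> 'a \<Rightarrow> real)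
      \<Rightarrow> 'a measure \<Rightarrow> 'h hs" where
  "kernel_cov k fn P = (\<integral>x. tensor_square (kernel_section k fn x - kernel_mean k fn P) \<partial>P)"

definition sample_mean ::
    "('a \<Rightarrow> 'a \<Rightarrow> real) \<Rightarrow> ('h::{real_inner, banach, second_countable_topology} \<Rightarrow> 'a \<Rightarrow> real)
      \<Rightarrow> nat \<Rightarrow> (nat \<Rightarrow> 'a) \<Rightarrow> 'h" where
  "sample_mean k fn n x = (1 / real n) *\<^sub>R (\<Sum>i<n. kernel_section k fn (x i))"

definition sample_cov ::
    "('a \<Rightarrow> 'a \<Rightarrow> real) \<Rightarrow> ('h::{real_inner, banach, second_countable_topology} \<Rightarrow> 'a \<Rightarrow> real)
      \<Rightarrow> nat \<Rightarrow> (nat \<Rightarrow> 'a) \<Rightarrow> 'h hs" where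
  "sample_cov k fn n x =
     (1 / real n) *\<^sub>R (\<Sum>i<n. tensor_square (kernel_section k fn (x i) - sample_mean k fn n x))"

definition test_statistic ::
    "('a \<Rightarrow> 'a \<Rightarrow> real) \<Rightarrow> ('h::{real_inner, banach, second_countable_topology} \<Rightarrow> 'a \<Rightarrow> real)
      \<Rightarrow> nat \<Rightarrow> nat \<Rightarrow> (nat \<Rightarrow> 'a) \<Rightarrow> (nat \<Rightarrow> 'a) \<Rightarrow> real" where
  "test_statistic k fn n m x y = (norm (sample_cov k fn n x - sample_cov k fn m y))\<^sup>2"

definition cov_discrepancy ::
    "('a \<Rightarrow> 'a \<Rightarrow> real) \<Rightarrow> ('h::{real_inner, banach, second_countable_topology} \<Rightarrow> 'a \<Rightarrow> real)
      \<Rightarrow> 'a measure \<Rightarrow> 'a measure \<Rightarrow> real" where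
  "cov_discrepancy k fn P Q = (norm (kernel_cov k fn P - kernel_cov k fn Q))\<^sup>2"

definition projected_variance ::
    "('a \<Rightarrow> 'a \<Rightarrow> real) \<Rightarrow> ('h::{real_inner, banach, second_countable_topology} \<Rightarrow> 'a \<Rightarrow> real)
      \<Rightarrow> 'h hs \<Rightarrow> 'a measure \<Rightarrow> real" where
  "projected_variance k fn D R =
     prob_space.variance R
       (\<lambda>x. D \<bullet> (tensor_square (kernel_section k fn x - kernel_mean k fn R) - kernel_cov k fn R))"


section \<open>Normal laws on the real line\<close>

definition normal_law :: "real \<Rightarrow> real \<Rightarrow> real measure" where
  "normal_law \<mu> v =
     (if v = 0 then return borel \<mu> else density lborel (normal_density \<mu> (sqrt v)))"

end

theory Submission
  imports Defs
begin

text \<open>Write \<open>\<phi>\<close> for the kernel section, \<open>\<mu>\<close> and \<open>\<Sigma>\<close> for the mean and covariance of \<open>\<phi>\<close> under \<open>P\<close>, and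
  \<open>D = \<Sigma>(P) - \<Sigma>(Q)\<close>. The estimation error of a sample covariance is \<open>U - Z \<otimes>\<^sub>h Z\<close>, where \<open>U\<close> and \<open>Z\<close>
  are the averages of the independent centred variables \<open>(\<phi>(X\<^sub>i) - \<mu>) \<otimes>\<^sub>h (\<phi>(X\<^sub>i) - \<mu>) - \<Sigma>\<close> and
  \<open>\<phi>(X\<^sub>i) - \<mu>\<close> (\<open>sample_cov_decomposition\<close>). Expanding \<open>\<parallel>\<cdot>\<parallel>\<^sup>2\<close> around \<open>D\<close> splits the centred statistic
  into twice \<open>D \<bullet> U(P) - D \<bullet> U(Q)\<close> and a remainder that is of second or higher order in the averages \<open>U\<close>, \<open>Z\<close> of
  the two samples.

  The fourth moment of \<open>\<phi>\<close> makes the averaged variables square integrable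
  (\<open>centered_tensor_square_moments\<close>), so these averages have mean squares of order \<open>1/n\<close> and \<open>1/m\<close>
  (\<open>mean_square_sample_mean\<close>), and the remainder multiplied by \<open>sqrt (n + m)\<close> tends to \<open>0\<close> in
  probability. Convergence in probability is measured by \<open>E min(1, |\<cdot>|)\<close>: under the truncation the
  quartic part of the remainder is controlled by second moments (\<open>norm_square_expansion_remainder\<close>),
  and the same quantity bounds the change of characteristic functions (\<open>char_distr_diff_le\<close>).

  The linear part is a sum of two independent normalized sums of real variables with variances
  \<open>v\<^sub>P\<^sup>2\<close> and \<open>v\<^sub>Q\<^sup>2\<close>, whose weights tend to \<open>2 / sqrt \<rho>\<close> and \<open>- 2 / sqrt (1 - \<rho>)\<close>. The classical central
  limit theorem for each sample and multiplicativity of characteristic functions give the Gaussian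
  limit (\<open>char_two_sample_tendsto\<close>), also when one or both variances vanish. Levy's continuity
  theorem transfers it to the statistic (\<open>weak_conv_m_of_char_perturbation\<close>).\<close>

section \<open>The tensor product as a continuous bilinear map\<close>

text \<open>The squared Hilbert--Schmidt norm is \<open>\<parallel>g\<parallel>\<^sup>2\<close> times the sum of the squared coefficients of \<open>h\<close>, and
  Bessel's inequality bounds the finite partial sums.\<close>
lemma norm_tensor_le: "norm (g \<otimes>\<^sub>h h) \<le> norm g * norm h"
proof (rule power2_le_imp_le)
  have "(norm (g \<otimes>\<^sub>h h))\<^sup>2 \<le> (norm h)\<^sup>2 * (norm g)\<^sup>2"
    unfolding norm_hs_square
  proof (rule infsum_le_finite_sums[OF hs_op_summable])
    fix F :: "'a set" assume F: "finite F" "F \<subseteq> onb"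
    have "(\<Sum>e\<in>F. (norm (hs_op (g \<otimes>\<^sub>h h) e))\<^sup>2) = (\<Sum>e\<in>F. (h \<bullet> e)\<^sup>2) * (norm g)\<^sup>2"
      by (simp add: tensor_apply power_mult_distrib sum_distrib_right)
    also have "\<dots> \<le> (norm h)\<^sup>2 * (norm g)\<^sup>2"
      using bessel_finite[OF F(1) orthonormal_subset[OF orthonormal_onb F(2)]]
      by (intro mult_right_mono) auto
    finally show "(\<Sum>e\<in>F. (norm (hs_op (g \<otimes>\<^sub>h h) e))\<^sup>2) \<le> (norm h)\<^sup>2 * (norm g)\<^sup>2" .
  qed
  then show "(norm (g \<otimes>\<^sub>h h))\<^sup>2 \<le> (norm g * norm h)\<^sup>2"
    by (simp add: power_mult_distrib mult.commute)
qed simp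

lemma hs_eqI: "(\<And>x. hs_op A x = hs_op B x) \<Longrightarrow> A = B"
  by (metis blinfun_eqI hs_op_inject)

lemma bounded_bilinear_tensor: "bounded_bilinear (\<otimes>\<^sub>h)"
proof
  show "\<exists>K. \<forall>a b. norm (a \<otimes>\<^sub>h b) \<le> norm a * norm b * K"
    by (intro exI[of _ 1]) (simp add: norm_tensor_le)
qed (auto intro!: hs_eqI simp: tensor_apply plus_hs.rep_eq scaleR_hs.rep_eq plus_blinfun.rep_eq
      scaleR_blinfun.rep_eq inner_add_left scaleR_add_left scaleR_add_right mult.commute)

interpretation tensor: bounded_bilinear "(\<otimes>\<^sub>h)"
  by (rule bounded_bilinear_tensor)

lemma continuous_tensor_square: "continuous_on UNIV (\<lambda>h. tensor_square h)"
  by (intro tensor.continuous_on continuous_on_id)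

lemma borel_measurable_tensor_square [measurable (raw)]:
  "f \<in> borel_measurable M \<Longrightarrow> (\<lambda>x. tensor_square (f x)) \<in> borel_measurable M"
  by (rule borel_measurable_continuous_on[OF continuous_tensor_square])


section \<open>Expansion of the statistic\<close>

text \<open>The operator form of \<open>Var Z = E Z\<^sup>2 - (E Z)\<^sup>2\<close> under the empirical measure; it holds because
  the cross terms \<open>z i \<otimes>\<^sub>h zm\<close> and \<open>zm \<otimes>\<^sub>h z i\<close> each sum to \<open>n\<close> copies of \<open>zm \<otimes>\<^sub>h zm\<close>.\<close>
lemma empirical_covariance_shift:
  fixes z :: "nat \<Rightarrow> 'h::{real_inner, banach, second_countable_topology}"
  assumes n: "n > 0"
  defines "zm \<equiv> (1 / real n) *\<^sub>R (\<Sum>i<n. z i)"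
  shows "(1 / real n) *\<^sub>R (\<Sum>i<n. tensor_square (z i - zm)) =
    (1 / real n) *\<^sub>R (\<Sum>i<n. tensor_square (z i)) - tensor_square zm"
proof -
  have s: "(\<Sum>i<n. z i) = real n *\<^sub>R zm" using n by (simp add: zm_def)
  have "(\<Sum>i<n. tensor_square (z i - zm)) =
      (\<Sum>i<n. tensor_square (z i) - z i \<otimes>\<^sub>h zm - zm \<otimes>\<^sub>h z i + tensor_square zm)"
    by (simp add: tensor.diff_left tensor.diff_right algebra_simps)
  also have "\<dots> = (\<Sum>i<n. tensor_square (z i)) - (\<Sum>i<n. z i) \<otimes>\<^sub>h zm - zm \<otimes>\<^sub>h (\<Sum>i<n. z i)
      + real n *\<^sub>R tensor_square zm"
    by (simp add: sum.distrib sum_subtractf tensor.sum_left tensor.sum_right sum_constant_scaleR)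
  also have "\<dots> = (\<Sum>i<n. tensor_square (z i)) - real n *\<^sub>R tensor_square zm"
    by (simp add: s tensor.scaleR_left tensor.scaleR_right)
  finally show ?thesis using n by (simp add: scaleR_diff_right)
qed

text \<open>The sample covariance does not change when all kernel sections are shifted by a common \<open>c\<close>. Taking
  the population mean for \<open>c\<close> and the population covariance for \<open>S\<close> exhibits the estimation error as
  an average of independent centred terms minus the square of an average of independent centred
  vectors, the latter being of smaller order.\<close>
lemma sample_cov_decomposition:
  fixes fn :: "'h::{real_inner, banach, second_countable_topology} \<Rightarrow> 'a \<Rightarrow> real"
    and k :: "'a \<Rightarrow> 'a \<Rightarrow> real" and x :: "nat \<Rightarrow> 'a" and c :: 'h and S :: "'h hs"
  assumes n: "n > 0"
  defines "Z \<equiv> \<lambda>i. kernel_section k fn (x i) - c"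
  shows "sample_cov k fn n x =
    S + (1 / real n) *\<^sub>R (\<Sum>i<n. tensor_square (Z i) - S) - tensor_square ((1 / real n) *\<^sub>R (\<Sum>i<n. Z i))"
proof -
  let ?zm = "(1 / real n) *\<^sub>R (\<Sum>i<n. Z i)"
  have m: "?zm = sample_mean k fn n x - c"
    using n by (simp add: Z_def sample_mean_def sum_subtractf scaleR_diff_right sum_constant_scaleR)
  have "sample_cov k fn n x = (1 / real n) *\<^sub>R (\<Sum>i<n. tensor_square (Z i - ?zm))"
    unfolding m sample_cov_def by (simp add: Z_def)
  also have "\<dots> = (1 / real n) *\<^sub>R (\<Sum>i<n. tensor_square (Z i)) - tensor_square ?zm"
    by (rule empirical_covariance_shift[OF n])
  also have "(1 / real n) *\<^sub>R (\<Sum>i<n. tensor_square (Z i)) =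
      S + (1 / real n) *\<^sub>R (\<Sum>i<n. tensor_square (Z i) - S)"
    using n by (simp add: sum_subtractf scaleR_diff_right sum_constant_scaleR)
  finally show ?thesis .
qed

text \<open>The second-order remainder of \<open>\<parallel>\<cdot>\<parallel>\<^sup>2\<close> at \<open>D\<close>, for the increment that the sample covariances produce:
  \<open>u\<close>, \<open>v\<close> stand for averages of centred operators, and \<open>z\<close>, \<open>w\<close> for the squared norms of averages of
  centred vectors. The squared norm of the increment contains \<open>z\<^sup>2\<close> and \<open>w\<^sup>2\<close>, which are fourth powers
  of vector averages; the truncation at \<open>1\<close> makes it possible to bound everything by
  second moments only.\<close>
lemma norm_square_expansion_remainder:
  fixes D u v p q :: "'b::real_inner"
  assumes N: "N \<ge> 1" and p: "norm p \<le> z" and q: "norm q \<le> w"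
  defines "R \<equiv> (norm (D + (u - p) - (v - q)))\<^sup>2 - (norm D)\<^sup>2 - 2 * (D \<bullet> u - D \<bullet> v)"
  shows "min 1 \<bar>sqrt N * R\<bar> \<le>
    (2 * norm D + 4) * (sqrt N * ((norm u)\<^sup>2 + (norm v)\<^sup>2 + z + w))"
proof -
  define r where "r = sqrt N"
  have r: "r \<ge> 1" using N by (simp add: r_def)
  have zw: "z \<ge> 0" "w \<ge> 0" using p q norm_ge_zero order_trans by blast+
  have R: "R = 2 * (D \<bullet> q - D \<bullet> p) + (norm ((u - p) - (v - q)))\<^sup>2"
    unfolding R_def power2_norm_eq_inner
    by (simp add: inner_diff_left inner_diff_right inner_add_left inner_add_right inner_commute)
  have sq4: "(a + b + c + d)\<^sup>2 \<le> 4 * (a\<^sup>2 + b\<^sup>2 + c\<^sup>2 + d\<^sup>2)" for a b c d :: real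
    using sum_squares_ge_zero[of "a - b" "c - d"] sum_squares_ge_zero[of "a - c" "b - d"]
      sum_squares_ge_zero[of "a - d" "b - c"]
    by (simp add: power2_eq_square algebra_simps)
  have "norm ((u - p) - (v - q)) \<le> norm u + norm v + norm p + norm q"
    by (smt (verit) norm_triangle_ineq4)
  also have "\<dots> \<le> norm u + norm v + z + w" using p q by simp
  finally have "(norm ((u - p) - (v - q)))\<^sup>2 \<le> (norm u + norm v + z + w)\<^sup>2"
    by (intro power_mono) auto
  also note sq4
  finally have quad: "(norm ((u - p) - (v - q)))\<^sup>2 \<le> 4 * ((norm u)\<^sup>2 + (norm v)\<^sup>2 + z\<^sup>2 + w\<^sup>2)" .
  have "\<bar>D \<bullet> p\<bar> \<le> norm D * z" "\<bar>D \<bullet> q\<bar> \<le> norm D * w"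
    using p q by (meson Cauchy_Schwarz_ineq2 mult_left_mono norm_ge_zero order_trans)+
  then have "\<bar>D \<bullet> q - D \<bullet> p\<bar> \<le> norm D * z + norm D * w" by linarith
  with quad have "\<bar>R\<bar> \<le> 2 * (norm D * z + norm D * w) + 4 * ((norm u)\<^sup>2 + (norm v)\<^sup>2 + z\<^sup>2 + w\<^sup>2)"
    unfolding R by (intro order_trans[OF abs_triangle_ineq] add_mono) (auto simp: abs_mult)
  also have "\<dots> = 2 * norm D * (z + w) + 4 * ((norm u)\<^sup>2 + (norm v)\<^sup>2) + 4 * (z\<^sup>2 + w\<^sup>2)"
    by (simp add: algebra_simps)
  finally have "\<bar>R\<bar> \<le> 2 * norm D * (z + w) + 4 * ((norm u)\<^sup>2 + (norm v)\<^sup>2) + 4 * (z\<^sup>2 + w\<^sup>2)" .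
  then have "r * \<bar>R\<bar> \<le> r * (2 * norm D * (z + w) + 4 * ((norm u)\<^sup>2 + (norm v)\<^sup>2) + 4 * (z\<^sup>2 + w\<^sup>2))"
    using r by (intro mult_left_mono) auto
  also have "\<dots> = 2 * norm D * (r * (z + w)) + 4 * (r * ((norm u)\<^sup>2 + (norm v)\<^sup>2)) + 4 * (r * (z\<^sup>2 + w\<^sup>2))"
    by (simp add: algebra_simps)
  finally have main: "r * \<bar>R\<bar> \<le> \<dots>" .
  \<comment> \<open>Truncation at \<open>1\<close> turns the fourth-order terms into second-order ones,
    as \<open>min 1 (y\<^sup>2) \<le> y\<close> for \<open>y \<ge> 0\<close>.\<close>
  have min4: "min 1 (4 * (r * (z\<^sup>2 + w\<^sup>2))) \<le> 4 * (r * (z + w))"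
  proof (cases "r * (z + w) \<le> 1")
    case True
    have "r * (z\<^sup>2 + w\<^sup>2) \<le> r * r * (z + w)\<^sup>2"
      using r zw by (intro mult_mono) (auto simp: power2_eq_square algebra_simps mult_left_le)
    also have "\<dots> = (r * (z + w)) * (r * (z + w))" by (simp add: power2_eq_square)
    also have "\<dots> \<le> (r * (z + w)) * 1" using True r zw by (intro mult_left_mono) auto
    finally show ?thesis by simp
  next
    case False then show ?thesis by linarith
  qed
  have nn: "0 \<le> r * (z + w)" "0 \<le> r * ((norm u)\<^sup>2 + (norm v)\<^sup>2)" using r zw by auto
  have trunc: "min 1 x \<le> a + min 1 b" if "x \<le> a + b" "0 \<le> a" for x a b :: real
    using that by (simp add: min_def)
  have "min 1 \<bar>r * R\<bar> \<le> 2 * norm D * (r * (z + w)) + 4 * (r * ((norm u)\<^sup>2 + (norm v)\<^sup>2))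
      + min 1 (4 * (r * (z\<^sup>2 + w\<^sup>2)))"
    by (rule trunc) (use main nn r in \<open>simp_all add: abs_mult\<close>)
  also have "\<dots> \<le> 2 * norm D * (r * (z + w)) + 4 * (r * ((norm u)\<^sup>2 + (norm v)\<^sup>2)) + 4 * (r * (z + w))"
    using min4 by simp
  also have "\<dots> \<le> (2 * norm D + 4) * (r * ((norm u)\<^sup>2 + (norm v)\<^sup>2 + z + w))"
    using nn mult_nonneg_nonneg[OF norm_ge_zero[of D] nn(2)] by (simp add: algebra_simps)
  finally show ?thesis unfolding r_def .
qed


section \<open>Averages of independent Hilbert-space-valued variables\<close>

lemma (in prob_space) indep_var_of_indep_vars:
  assumes ind: "indep_vars M' X I" and ij: "i \<in> I" "j \<in> I" "i \<noteq> j"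
  shows "indep_var (M' i) (X i) (M' j) (X j)"
proof -
  have "indep_var
    (M' i) ((\<lambda>f. f i) \<circ> (\<lambda>\<omega>. restrict (\<lambda>i. X i \<omega>) {i}))
    (M' j) ((\<lambda>f. f j) \<circ> (\<lambda>\<omega>. restrict (\<lambda>i. X i \<omega>) {j}))"
    using ij by (intro indep_var_compose[OF indep_var_restrict[OF ind]]) auto
  then show ?thesis by (simp add: comp_def)
qed

lemma (in prob_space) indep_vars_reindex:
  assumes ind: "indep_vars M' X (f ` J)" and inj: "inj_on f J"
  shows "indep_vars (\<lambda>j. M' (f j)) (\<lambda>j. X (f j)) J"
proof -
  have "indep_vars (\<lambda>j. PiM {f j} M') (\<lambda>j \<omega>. restrict (\<lambda>i. X i \<omega>) {f j}) J"
    using inj by (intro indep_vars_restrict[OF ind]) (auto simp: disjoint_family_on_def inj_on_def)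
  then have "indep_vars (\<lambda>j. M' (f j)) (\<lambda>j \<omega>. (restrict (\<lambda>i. X i \<omega>) {f j}) (f j)) J"
    by (rule indep_vars_compose2) auto
  then show ?thesis by simp
qed

lemma (in finite_measure) integrable_of_norm_square:
  fixes f :: "'a \<Rightarrow> 'b::{banach, second_countable_topology}"
  assumes f: "f \<in> borel_measurable M" and sq: "integrable M (\<lambda>x. (norm (f x))\<^sup>2)"
  shows "integrable M f"
  using square_integrable_imp_integrable[of "\<lambda>x. norm (f x)"] assms
  by (simp add: integrable_norm_iff)

text \<open>Independence turns the joint law into a product measure. The inner integral of \<open>x \<bullet> y\<close> in \<open>y\<close> is
  \<open>x \<bullet> E Y\<close> because a Bochner integral commutes with the bounded functional \<open>(\<bullet>) x\<close>.\<close>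
lemma (in prob_space) expectation_inner_indep:
  fixes X Y :: "'a \<Rightarrow> 'b::{real_inner, banach, second_countable_topology}"
  assumes ind: "indep_var borel X borel Y" and X: "integrable M X" and Y: "integrable M Y"
  shows "integrable M (\<lambda>\<omega>. X \<omega> \<bullet> Y \<omega>)"
    and "expectation (\<lambda>\<omega>. X \<omega> \<bullet> Y \<omega>) = expectation X \<bullet> expectation Y"
proof -
  have [measurable]: "random_variable borel X" "random_variable borel Y"
    using X Y by auto
  have "indep_var borel (\<lambda>\<omega>. norm (X \<omega>)) borel (\<lambda>\<omega>. norm (Y \<omega>))"
    using indep_var_compose[OF ind, of norm borel norm borel] by (simp add: comp_def)
  then have "integrable M (\<lambda>\<omega>. norm (X \<omega>) * norm (Y \<omega>))"
    using X Y by (intro indep_var_integrable) auto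
  then show int: "integrable M (\<lambda>\<omega>. X \<omega> \<bullet> Y \<omega>)"
    by (rule Bochner_Integration.integrable_bound) (auto simp: Cauchy_Schwarz_ineq2)
  interpret X: prob_space "distr M borel X" by (rule prob_space_distr) simp
  interpret Y: prob_space "distr M borel Y" by (rule prob_space_distr) simp
  interpret XY: pair_prob_space "distr M borel X" "distr M borel Y" ..
  have joint: "distr M borel X \<Otimes>\<^sub>M distr M borel Y = distr M (borel \<Otimes>\<^sub>M borel) (\<lambda>\<omega>. (X \<omega>, Y \<omega>))"
    using ind unfolding indep_var_distribution_eq by simp
  have intp: "integrable (distr M borel X \<Otimes>\<^sub>M distr M borel Y) (\<lambda>(x, y). x \<bullet> y)"
    unfolding joint by (subst integrable_distr_eq) (auto simp: int split_beta')
  have "expectation (\<lambda>\<omega>. X \<omega> \<bullet> Y \<omega>) = (\<integral>p. (\<lambda>(x, y). x \<bullet> y) p \<partial>(distr M borel X \<Otimes>\<^sub>M distr M borel Y))"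
    unfolding joint by (subst integral_distr) (auto simp: split_beta')
  also have "\<dots> = (\<integral>x. (\<integral>y. x \<bullet> y \<partial>distr M borel Y) \<partial>distr M borel X)"
    using XY.integral_fst'[OF intp] by simp
  also have "\<dots> = (\<integral>x. x \<bullet> expectation Y \<partial>distr M borel X)"
    by (simp add: integral_distr Y)
  also have "\<dots> = expectation X \<bullet> expectation Y"
    by (simp add: integral_distr X)
  finally show "expectation (\<lambda>\<omega>. X \<omega> \<bullet> Y \<omega>) = expectation X \<bullet> expectation Y" .
qed

text \<open>Independent centred vectors are orthogonal in \<open>L\<^sup>2\<close>, so only the \<open>n\<close> diagonal terms of the expanded
  square survive.\<close>
lemma (in prob_space) mean_square_sample_mean:
  fixes \<xi> :: "nat \<Rightarrow> 'a \<Rightarrow> 'b::{real_inner, banach, second_countable_topology}"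
  assumes ind: "indep_vars (\<lambda>_. borel) \<xi> UNIV"
    and mean: "\<And>i. expectation (\<xi> i) = 0"
    and sq: "\<And>i. integrable M (\<lambda>\<omega>. (norm (\<xi> i \<omega>))\<^sup>2)"
    and C: "\<And>i. expectation (\<lambda>\<omega>. (norm (\<xi> i \<omega>))\<^sup>2) = C"
  shows "integrable M (\<lambda>\<omega>. (norm ((1 / real n) *\<^sub>R (\<Sum>i<n. \<xi> i \<omega>)))\<^sup>2)"
    and "expectation (\<lambda>\<omega>. (norm ((1 / real n) *\<^sub>R (\<Sum>i<n. \<xi> i \<omega>)))\<^sup>2) = C / real n"
proof -
  have rv [measurable]: "random_variable borel (\<xi> i)" for i
    using ind unfolding indep_vars_def2 by simp
  have int: "integrable M (\<xi> i)" for i by (rule integrable_of_norm_square) (use sq in auto)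
  have ij: "integrable M (\<lambda>\<omega>. \<xi> i \<omega> \<bullet> \<xi> j \<omega>) \<and>
      expectation (\<lambda>\<omega>. \<xi> i \<omega> \<bullet> \<xi> j \<omega>) = (if i = j then C else 0)" for i j
  proof (cases "i = j")
    case True then show ?thesis using sq C by (simp add: power2_norm_eq_inner)
  next
    case False
    have "indep_var borel (\<xi> i) borel (\<xi> j)"
      by (rule indep_var_of_indep_vars[OF ind]) (use False in auto)
    from expectation_inner_indep[OF this int int] show ?thesis using False mean by simp
  qed
  have eq: "(norm ((1 / real n) *\<^sub>R (\<Sum>i<n. \<xi> i \<omega>)))\<^sup>2 = (1 / (real n)\<^sup>2) * (\<Sum>i<n. \<Sum>j<n. \<xi> i \<omega> \<bullet> \<xi> j \<omega>)"
    for \<omega>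
  proof -
    have "(\<Sum>i<n. \<xi> i \<omega>) \<bullet> (\<Sum>j<n. \<xi> j \<omega>) = (\<Sum>i<n. \<Sum>j<n. \<xi> i \<omega> \<bullet> \<xi> j \<omega>)"
      by (subst inner_sum_left) (rule sum.cong[OF refl inner_sum_right])
    then show ?thesis by (simp add: power_divide power2_norm_eq_inner)
  qed
  show "integrable M (\<lambda>\<omega>. (norm ((1 / real n) *\<^sub>R (\<Sum>i<n. \<xi> i \<omega>)))\<^sup>2)"
    unfolding eq using ij by (intro integrable_mult_right integrable_sum) auto
  have "expectation (\<lambda>\<omega>. (norm ((1 / real n) *\<^sub>R (\<Sum>i<n. \<xi> i \<omega>)))\<^sup>2) =
      (1 / (real n)\<^sup>2) * (\<Sum>i<n. \<Sum>j<n. if i = j then C else 0)"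
    unfolding eq using ij by (simp add: Bochner_Integration.integral_sum Bochner_Integration.integrable_sum)
  also have "\<dots> = C / real n" by (simp add: power2_eq_square)
  finally show "expectation (\<lambda>\<omega>. (norm ((1 / real n) *\<^sub>R (\<Sum>i<n. \<xi> i \<omega>)))\<^sup>2) = C / real n" .
qed

lemma power2_power2: "(x\<^sup>2)\<^sup>2 = (x :: 'a :: monoid_mult) ^ 4"
  using power_mult[of x 2 2] by simp

lemma power4_sum_le:
  fixes a b :: real assumes "0 \<le> a" "0 \<le> b"
  shows "(a + b) ^ 4 \<le> 8 * (a ^ 4 + b ^ 4)"
proof -
  have sq: "(x + y)\<^sup>2 \<le> 2 * (x\<^sup>2 + y\<^sup>2)" for x y :: real
    using zero_le_power2[of "x - y"] by (simp add: power2_sum power2_diff)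
  have "(a + b) ^ 4 = ((a + b)\<^sup>2)\<^sup>2" by (simp add: power2_power2)
  also have "\<dots> \<le> (2 * (a\<^sup>2 + b\<^sup>2))\<^sup>2" by (rule power_mono[OF sq]) simp
  also have "\<dots> = 4 * (a\<^sup>2 + b\<^sup>2)\<^sup>2" by (subst power_mult_distrib) simp
  also have "\<dots> \<le> 4 * (2 * ((a\<^sup>2)\<^sup>2 + (b\<^sup>2)\<^sup>2))" using sq[of "a\<^sup>2" "b\<^sup>2"] by simp
  finally show ?thesis by (simp add: power2_power2)
qed

text \<open>Since \<open>\<parallel>Z \<otimes>\<^sub>h Z\<parallel> \<le> \<parallel>Z\<parallel>\<^sup>2\<close>, a fourth moment of \<open>f\<close> is what makes the centred tensor square
  square integrable.\<close>
lemma (in prob_space) centered_tensor_square_moments: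
  fixes f :: "'a \<Rightarrow> 'h::{real_inner, banach, second_countable_topology}"
  assumes f [measurable]: "f \<in> borel_measurable M" and f4: "integrable M (\<lambda>x. norm (f x) ^ 4)"
  defines "Z \<equiv> \<lambda>x. f x - expectation f"
  defines "U \<equiv> \<lambda>x. tensor_square (Z x) - expectation (\<lambda>x. tensor_square (Z x))"
  shows "integrable M (\<lambda>x. (norm (Z x))\<^sup>2)" "expectation Z = 0"
    and "integrable M (\<lambda>x. (norm (U x))\<^sup>2)" "expectation U = 0"
proof -
  have Z [measurable]: "Z \<in> borel_measurable M" unfolding Z_def by simp
  have "integrable M (\<lambda>x. (norm (f x))\<^sup>2)"
    by (rule square_integrable_imp_integrable) (use f4 in \<open>simp_all add: power2_power2\<close>)
  then have fi: "integrable M f" by (rule integrable_of_norm_square[OF f])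
  have Z4: "integrable M (\<lambda>x. norm (Z x) ^ 4)"
  proof (rule Bochner_Integration.integrable_bound)
    show "integrable M (\<lambda>x. 8 * (norm (f x) ^ 4 + norm (expectation f) ^ 4))" using f4 by simp
    have "norm (Z x) ^ 4 \<le> 8 * (norm (f x) ^ 4 + norm (expectation f) ^ 4)" for x
    proof -
      have "norm (Z x) ^ 4 \<le> (norm (f x) + norm (expectation f)) ^ 4"
        unfolding Z_def by (intro power_mono norm_triangle_ineq4) simp
      also note power4_sum_le[OF norm_ge_zero norm_ge_zero]
      finally show ?thesis .
    qed
    then show "AE x in M. norm (norm (Z x) ^ 4) \<le> norm (8 * (norm (f x) ^ 4 + norm (expectation f) ^ 4))"
      by auto
  qed simp
  show Z2: "integrable M (\<lambda>x. (norm (Z x))\<^sup>2)"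
    by (rule square_integrable_imp_integrable) (use Z4 in \<open>simp_all add: power2_power2\<close>)
  show "expectation Z = 0" unfolding Z_def using fi by (simp add: prob_space)
  let ?S = "expectation (\<lambda>x. tensor_square (Z x))"
  have TZ: "norm (tensor_square (Z x)) \<le> (norm (Z x))\<^sup>2" for x
    using norm_tensor_le[of "Z x" "Z x"] by (simp add: power2_eq_square)
  have Ti: "integrable M (\<lambda>x. tensor_square (Z x))"
    by (rule Bochner_Integration.integrable_bound[OF Z2]) (auto simp: TZ)
  then show "expectation U = 0" unfolding U_def by (simp add: prob_space)
  show "integrable M (\<lambda>x. (norm (U x))\<^sup>2)"
  proof (rule Bochner_Integration.integrable_bound)
    show "integrable M (\<lambda>x. 2 * (norm (Z x) ^ 4 + (norm ?S)\<^sup>2))" using Z4 by simp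
    have "(norm (U x))\<^sup>2 \<le> 2 * (norm (Z x) ^ 4 + (norm ?S)\<^sup>2)" for x
    proof -
      have "(norm (U x))\<^sup>2 \<le> ((norm (Z x))\<^sup>2 + norm ?S)\<^sup>2"
        unfolding U_def using TZ[of x] norm_triangle_ineq4[of "tensor_square (Z x)" ?S]
        by (intro power_mono) auto
      also have "\<dots> \<le> 2 * (((norm (Z x))\<^sup>2)\<^sup>2 + (norm ?S)\<^sup>2)"
        using zero_le_power2[of "(norm (Z x))\<^sup>2 - norm ?S"] by (simp add: power2_sum power2_diff)
      finally show ?thesis by (simp add: power2_power2)
    qed
    then show "AE x in M. norm ((norm (U x))\<^sup>2) \<le> norm (2 * (norm (Z x) ^ 4 + (norm ?S)\<^sup>2))"
      by auto
  qed (simp add: U_def)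
qed


section \<open>Characteristic functions and normal limits\<close>

lemma (in prob_space) char_distr_mult:
  assumes [measurable]: "random_variable borel f"
  shows "char (distr M borel (\<lambda>\<omega>. c * f \<omega>)) t = char (distr M borel f) (c * t)"
  unfolding char_def by (simp add: integral_distr mult_ac)

lemma cmod_iexp_diff_le: "cmod (iexp (t * a) - iexp (t * b)) \<le> (2 + \<bar>t\<bar>) * min 1 \<bar>a - b\<bar>"
proof -
  have "iexp (t * a) - iexp (t * b) = iexp (t * b) * (iexp (t * (a - b)) - 1)"
    by (simp add: algebra_simps flip: exp_add)
  then have eq: "cmod (iexp (t * a) - iexp (t * b)) = cmod (iexp (t * (a - b)) - 1)"
    by (simp add: norm_mult)
  have "cmod (iexp (t * (a - b)) - 1) \<le> \<bar>t * (a - b)\<bar>"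
    using iexp_approx1[of "t * (a - b)" 0] by simp
  moreover have "cmod (iexp (t * (a - b)) - 1) \<le> 2"
    using norm_triangle_ineq4[of "iexp (t * (a - b))" 1] by simp
  ultimately have "cmod (iexp (t * (a - b)) - 1) \<le> min 2 (\<bar>t\<bar> * \<bar>a - b\<bar>)"
    by (simp add: abs_mult)
  also have "\<dots> \<le> (2 + \<bar>t\<bar>) * min 1 \<bar>a - b\<bar>"
  proof (cases "1 \<le> \<bar>a - b\<bar>")
    case True
    then show ?thesis by (simp add: min.coboundedI1)
  next
    case False
    then show ?thesis by (intro min.coboundedI2) (simp add: mult_right_mono)
  qed
  finally show ?thesis unfolding eq .
qed

text \<open>The quantity \<open>E min(1, |f - g|)\<close> metrizes convergence in probability, so this estimate is a
  quantitative form of Slutsky's theorem.\<close>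
lemma (in prob_space) char_distr_diff_le:
  assumes [measurable]: "random_variable borel f" "random_variable borel g"
  shows "cmod (char (distr M borel f) t - char (distr M borel g) t)
    \<le> (2 + \<bar>t\<bar>) * expectation (\<lambda>\<omega>. min 1 \<bar>f \<omega> - g \<omega>\<bar>)"
proof -
  have i: "integrable M (\<lambda>\<omega>. iexp (t * f \<omega>))" "integrable M (\<lambda>\<omega>. iexp (t * g \<omega>))"
    by (auto intro!: integrable_iexp)
  have m: "integrable M (\<lambda>\<omega>. min 1 \<bar>f \<omega> - g \<omega>\<bar>)"
    by (rule integrable_const_bound[of _ 1]) auto
  have "char (distr M borel f) t - char (distr M borel g) t =
      (CLINT \<omega>|M. iexp (t * f \<omega>) - iexp (t * g \<omega>))"
    using i by (simp add: char_def integral_distr)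
  also have "cmod \<dots> \<le> (\<integral>\<omega>. cmod (iexp (t * f \<omega>) - iexp (t * g \<omega>)) \<partial>M)"
    by (rule integral_norm_bound)
  also have "\<dots> \<le> (\<integral>\<omega>. (2 + \<bar>t\<bar>) * min 1 \<bar>f \<omega> - g \<omega>\<bar> \<partial>M)"
    using i m by (intro integral_mono cmod_iexp_diff_le) auto
  also have "\<dots> = (2 + \<bar>t\<bar>) * expectation (\<lambda>\<omega>. min 1 \<bar>f \<omega> - g \<omega>\<bar>)" by simp
  finally show ?thesis .
qed

lemma (in prob_space) weak_conv_m_of_char_perturbation:
  assumes [measurable]: "\<And>l. random_variable borel (f l)" "\<And>l. random_variable borel (g l)"
    and \<nu>: "real_distribution \<nu>"
    and char: "\<And>t. (\<lambda>l. char (distr M borel (g l)) t) \<longlonglongrightarrow> char \<nu> t"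
    and small: "(\<lambda>l. expectation (\<lambda>\<omega>. min 1 \<bar>f l \<omega> - g l \<omega>\<bar>)) \<longlonglongrightarrow> 0"
  shows "weak_conv_m (\<lambda>l. distr M borel (f l)) \<nu>"
proof (rule levy_continuity)
  fix t
  have "(\<lambda>l. (2 + \<bar>t\<bar>) * expectation (\<lambda>\<omega>. min 1 \<bar>f l \<omega> - g l \<omega>\<bar>)) \<longlonglongrightarrow> 0"
    using tendsto_mult_left[OF small, of "2 + \<bar>t\<bar>"] by simp
  then have "(\<lambda>l. char (distr M borel (f l)) t - char (distr M borel (g l)) t) \<longlonglongrightarrow> 0"
    by (rule Lim_null_comparison[rotated]) (intro always_eventually allI char_distr_diff_le; simp)
  from tendsto_add[OF this char[of t]]
  show "(\<lambda>l. char (distr M borel (f l)) t) \<longlonglongrightarrow> char \<nu> t" by simp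
qed (use \<nu> in \<open>auto intro: real_distribution_distr\<close>)

lemma real_distribution_normal_law: "0 \<le> v \<Longrightarrow> real_distribution (normal_law \<mu> v)"
  using prob_space_normal_density[of "sqrt v" \<mu>] prob_space_return[of \<mu> borel]
  by (auto simp: normal_law_def real_distribution_def real_distribution_axioms_def)

text \<open>A normal law of positive variance is a scaled standard one; the point mass, which has no density, is a
  case of its own.\<close>
lemma char_normal_law:
  assumes "0 \<le> v"
  shows "char (normal_law 0 v) t = exp (- (v * t\<^sup>2 / 2))"
proof (cases "v = 0")
  case True
  then show ?thesis by (simp add: normal_law_def char_def integral_return)
next
  case False
  interpret S: real_distribution std_normal_distribution by (rule real_dist_normal_dist)
  have "distributed std_normal_distribution lborel (\<lambda>x. x) std_normal_density"
    by (auto simp: distributed_def distr_id2)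
  from S.normal_density_affine[OF this, of "sqrt v" 0]
  have "distributed std_normal_distribution lborel (\<lambda>x. sqrt v * x) (normal_density 0 (sqrt v))"
    using assms False by simp
  then have "normal_law 0 v = distr std_normal_distribution lborel (\<lambda>x. sqrt v * x)"
    using False by (simp add: normal_law_def distributed_def)
  also have "\<dots> = distr std_normal_distribution borel (\<lambda>x. sqrt v * x)"
    by (rule distr_cong) auto
  finally have "char (normal_law 0 v) t = char (distr std_normal_distribution borel (\<lambda>x. x)) (sqrt v * t)"
    using S.char_distr_mult[of "\<lambda>x. x" "sqrt v" t] by simp
  also have "distr std_normal_distribution borel (\<lambda>x. x) = std_normal_distribution"
    by (rule distr_id2) simp
  finally show ?thesis using assms
    by (simp add: char_std_normal_distribution power_mult_distrib)
qed

text \<open>A central limit theorem that divides by \<open>sqrt n\<close> rather than by the standard deviation of the sum, so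
  that variance \<open>0\<close> is allowed: there the summands vanish almost surely. Positive variance is the
  classical theorem, rescaled.\<close>
lemma (in prob_space) char_normalized_iid_sum_tendsto:
  fixes \<xi> :: "nat \<Rightarrow> 'a \<Rightarrow> real"
  assumes ind: "indep_vars (\<lambda>_. borel) \<xi> UNIV"
    and law: "\<And>i. distr M borel (\<xi> i) = \<mu>"
    and mean: "\<And>i. expectation (\<xi> i) = 0"
    and sq: "\<And>i. integrable M (\<lambda>\<omega>. (\<xi> i \<omega>)\<^sup>2)"
    and v: "\<And>i. expectation (\<lambda>\<omega>. (\<xi> i \<omega>)\<^sup>2) = v"
  shows "(\<lambda>n. char (distr M borel (\<lambda>\<omega>. (\<Sum>i<n. \<xi> i \<omega>) / sqrt (real n))) t) \<longlonglongrightarrow> exp (- (v * t\<^sup>2 / 2))"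
proof -
  have rv [measurable]: "random_variable borel (\<xi> i)" for i
    using ind unfolding indep_vars_def2 by simp
  have v0: "0 \<le> v" by (auto simp flip: v[of 0])
  show ?thesis
  proof (cases "v = 0")
    case True
    have "AE \<omega> in M. \<xi> i \<omega> = 0" for i
      using integral_nonneg_eq_0_iff_AE[OF sq, of i] v[of i] True by simp
    then have ae: "AE \<omega> in M. \<forall>i. \<xi> i \<omega> = 0" by (simp add: AE_all_countable)
    have "char (distr M borel (\<lambda>\<omega>. (\<Sum>i<n. \<xi> i \<omega>) / sqrt (real n))) t = 1" for n
    proof -
      have "char (distr M borel (\<lambda>\<omega>. (\<Sum>i<n. \<xi> i \<omega>) / sqrt (real n))) t =
          (CLINT \<omega>|M. iexp (t * ((\<Sum>i<n. \<xi> i \<omega>) / sqrt (real n))))"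
        by (simp add: char_def integral_distr)
      also have "\<dots> = (CLINT \<omega>|M. 1)"
        using ae by (intro integral_cong_AE) auto
      finally show ?thesis by (simp add: prob_space)
    qed
    then show ?thesis using True by simp
  next
    case False
    then have s: "0 < sqrt v" using v0 by simp
    let ?S = "\<lambda>n \<omega>. (\<Sum>i<n. \<xi> i \<omega>) / sqrt (real n * (sqrt v)\<^sup>2)"
    have "weak_conv_m (\<lambda>n. distr M borel (?S n)) std_normal_distribution"
      using v0 by (intro central_limit_theorem_zero_mean[OF ind mean s sq _ law]) (simp add: mean v)
    then have "(\<lambda>n. char (distr M borel (?S n)) (sqrt v * t)) \<longlonglongrightarrow> char std_normal_distribution (sqrt v * t)"
      by (intro levy_continuity1 real_distribution_distr real_dist_normal_dist) auto
    also have "(\<lambda>n. char (distr M borel (?S n)) (sqrt v * t)) =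
        (\<lambda>n. char (distr M borel (\<lambda>\<omega>. (\<Sum>i<n. \<xi> i \<omega>) / sqrt (real n))) t)"
      using s v0 by (subst char_distr_mult[symmetric]) (auto simp: real_sqrt_mult)
    finally show ?thesis
      using v0 by (simp add: char_std_normal_distribution power_mult_distrib)
  qed
qed

text \<open>Indexing both samples by one sum type makes the two-sample combination a single sum of independent
  variables, whose characteristic function is a product; grouping the factors by sample gives the
  two one-sample characteristic functions.\<close>
lemma (in prob_space) char_two_sample_sum:
  fixes \<xi> :: "nat + nat \<Rightarrow> 'a \<Rightarrow> real"
  assumes ind: "indep_vars (\<lambda>_. borel) \<xi> UNIV"
  shows "char (distr M borel (\<lambda>\<omega>. a * (\<Sum>i<n. \<xi> (Inl i) \<omega>) + b * (\<Sum>j<m. \<xi> (Inr j) \<omega>))) t =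
    char (distr M borel (\<lambda>\<omega>. \<Sum>i<n. \<xi> (Inl i) \<omega>)) (a * t) *
    char (distr M borel (\<lambda>\<omega>. \<Sum>j<m. \<xi> (Inr j) \<omega>)) (b * t)"
proof -
  have rv [measurable]: "random_variable borel (\<xi> i)" for i
    using ind unfolding indep_vars_def2 by simp
  define c where "c i = (case i of Inl _ \<Rightarrow> a | Inr _ \<Rightarrow> b)" for i :: "nat + nat"
  have indc: "indep_vars (\<lambda>_. borel) (\<lambda>i \<omega>. c i * \<xi> i \<omega>) J" for J
    by (rule indep_vars_compose2[OF indep_vars_subset[OF ind]]) auto
  have indl: "indep_vars (\<lambda>_. borel) (\<lambda>i. \<xi> (Inl i)) J" and indr: "indep_vars (\<lambda>_. borel) (\<lambda>i. \<xi> (Inr i)) J" for J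
    using indep_vars_reindex[OF indep_vars_subset[OF ind], of Inl J]
      indep_vars_reindex[OF indep_vars_subset[OF ind], of Inr J] by auto
  have "(\<lambda>\<omega>. a * (\<Sum>i<n. \<xi> (Inl i) \<omega>) + b * (\<Sum>j<m. \<xi> (Inr j) \<omega>)) =
      (\<lambda>\<omega>. \<Sum>i\<in>{..<n} <+> {..<m}. c i * \<xi> i \<omega>)"
    by (simp add: sum.Plus c_def sum_distrib_left)
  then have "char (distr M borel (\<lambda>\<omega>. a * (\<Sum>i<n. \<xi> (Inl i) \<omega>) + b * (\<Sum>j<m. \<xi> (Inr j) \<omega>))) t =
      (\<Prod>i\<in>{..<n} <+> {..<m}. char (distr M borel (\<xi> i)) (c i * t))"
    by (simp add: char_distr_sum[OF indc] char_distr_mult)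
  also have "\<dots> = (\<Prod>i<n. char (distr M borel (\<xi> (Inl i))) (a * t)) * (\<Prod>j<m. char (distr M borel (\<xi> (Inr j))) (b * t))"
    by (simp add: prod.Plus c_def)
  finally show ?thesis by (simp add: char_distr_sum[OF indl] char_distr_sum[OF indr])
qed


section \<open>Functions of independent samples\<close>

context prob_space
begin

lemma iid_sample_mean:
  fixes g :: "'b \<Rightarrow> 'c::{real_inner, banach, second_countable_topology}"
  assumes ind: "indep_vars (\<lambda>_. A) X (UNIV :: nat set)" and law: "\<And>i. distr M A (X i) = P"
    and g: "g \<in> borel_measurable A" and sq: "integrable P (\<lambda>x. (norm (g x))\<^sup>2)"
    and mean: "(\<integral>x. g x \<partial>P) = 0"
  shows "integrable M (\<lambda>\<omega>. (norm ((1 / real n) *\<^sub>R (\<Sum>i<n. g (X i \<omega>))))\<^sup>2)"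
    and "expectation (\<lambda>\<omega>. (norm ((1 / real n) *\<^sub>R (\<Sum>i<n. g (X i \<omega>))))\<^sup>2) = (\<integral>x. (norm (g x))\<^sup>2 \<partial>P) / real n"
proof -
  have X: "X i \<in> measurable M A" for i using ind unfolding indep_vars_def2 by simp
  have "indep_vars (\<lambda>_. borel) (\<lambda>i \<omega>. g (X i \<omega>)) UNIV"
    by (rule indep_vars_compose2[OF ind]) (rule g)
  moreover have "expectation (\<lambda>\<omega>. g (X i \<omega>)) = 0" for i
    using mean unfolding law[of i, symmetric] by (simp add: integral_distr X g)
  moreover have "integrable M (\<lambda>\<omega>. (norm (g (X i \<omega>)))\<^sup>2)" for i
    using sq g unfolding law[of i, symmetric] by (subst (asm) integrable_distr_eq) (auto simp: X)
  moreover have "expectation (\<lambda>\<omega>. (norm (g (X i \<omega>)))\<^sup>2) = (\<integral>x. (norm (g x))\<^sup>2 \<partial>P)" for i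
    using g unfolding law[of i, symmetric] by (subst integral_distr) (auto simp: X)
  ultimately show "integrable M (\<lambda>\<omega>. (norm ((1 / real n) *\<^sub>R (\<Sum>i<n. g (X i \<omega>))))\<^sup>2)"
    and "expectation (\<lambda>\<omega>. (norm ((1 / real n) *\<^sub>R (\<Sum>i<n. g (X i \<omega>))))\<^sup>2) = (\<integral>x. (norm (g x))\<^sup>2 \<partial>P) / real n"
    by (rule mean_square_sample_mean)+
qed

lemma char_iid_sum_tendsto:
  fixes g :: "'b \<Rightarrow> real"
  assumes ind: "indep_vars (\<lambda>_. A) X (UNIV :: nat set)" and law: "\<And>i. distr M A (X i) = P"
    and g: "g \<in> borel_measurable A" and sq: "integrable P (\<lambda>x. (g x)\<^sup>2)" and mean: "(\<integral>x. g x \<partial>P) = 0"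
  shows "(\<lambda>n. char (distr M borel (\<lambda>\<omega>. (\<Sum>i<n. g (X i \<omega>)) / sqrt (real n))) t)
    \<longlonglongrightarrow> exp (- ((\<integral>x. (g x)\<^sup>2 \<partial>P) * t\<^sup>2 / 2))"
proof (rule char_normalized_iid_sum_tendsto)
  have X: "X i \<in> measurable M A" for i using ind unfolding indep_vars_def2 by simp
  show "indep_vars (\<lambda>_. borel) (\<lambda>i \<omega>. g (X i \<omega>)) UNIV"
    by (rule indep_vars_compose2[OF ind]) (rule g)
  show "distr M borel (\<lambda>\<omega>. g (X i \<omega>)) = distr P borel g" for i
    unfolding law[of i, symmetric] using X g by (subst distr_distr) (auto simp: comp_def)
  show "expectation (\<lambda>\<omega>. g (X i \<omega>)) = 0" for i
    using mean unfolding law[of i, symmetric] by (simp add: integral_distr X g)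
  show "integrable M (\<lambda>\<omega>. (g (X i \<omega>))\<^sup>2)" for i
    using sq g unfolding law[of i, symmetric] by (subst (asm) integrable_distr_eq) (auto simp: X)
  show "expectation (\<lambda>\<omega>. (g (X i \<omega>))\<^sup>2) = (\<integral>x. (g x)\<^sup>2 \<partial>P)" for i
    using g unfolding law[of i, symmetric] by (subst integral_distr) (auto simp: X)
qed

text \<open>The two normalized sums are independent, so the limit of the product of their characteristic functions
  is the product of two Gaussian ones, which is Gaussian with the weighted sum of the variances.\<close>
lemma char_two_sample_tendsto:
  fixes a b :: "'b \<Rightarrow> real" and X Y :: "nat \<Rightarrow> 'a \<Rightarrow> 'b"
  assumes ind: "indep_vars (\<lambda>_. A) (case_sum X Y) UNIV"
    and X: "\<And>i. distr M A (X i) = P" and Y: "\<And>i. distr M A (Y i) = Q"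
    and a: "a \<in> borel_measurable A" "integrable P (\<lambda>x. (a x)\<^sup>2)" "(\<integral>x. a x \<partial>P) = 0"
    and b: "b \<in> borel_measurable A" "integrable Q (\<lambda>x. (b x)\<^sup>2)" "(\<integral>x. b x \<partial>Q) = 0"
    and n: "filterlim n at_top sequentially" and m: "filterlim m at_top sequentially"
  shows "(\<lambda>l. char (distr M borel (\<lambda>\<omega>. \<alpha> * ((\<Sum>i<n l. a (X i \<omega>)) / sqrt (real (n l))) +
            \<beta> * ((\<Sum>j<m l. b (Y j \<omega>)) / sqrt (real (m l))))) t)
    \<longlonglongrightarrow> char (normal_law 0 (\<alpha>\<^sup>2 * (\<integral>x. (a x)\<^sup>2 \<partial>P) + \<beta>\<^sup>2 * (\<integral>x. (b x)\<^sup>2 \<partial>Q))) t"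
proof -
  define \<xi> where "\<xi> s \<omega> = case_sum (\<lambda>_. a) (\<lambda>_. b) s (case_sum X Y s \<omega>)" for s :: "nat + nat" and \<omega>
  have ind\<xi>: "indep_vars (\<lambda>_. borel) \<xi> UNIV"
    unfolding \<xi>_def by (rule indep_vars_compose2[OF ind]) (auto split: sum.split simp: a b)
  then have rv [measurable]: "random_variable borel (\<xi> s)" for s unfolding indep_vars_def2 by simp
  have indX: "indep_vars (\<lambda>_. A) X UNIV"
    using indep_vars_reindex[OF indep_vars_subset[OF ind], of Inl UNIV] by simp
  have indY: "indep_vars (\<lambda>_. A) Y UNIV"
    using indep_vars_reindex[OF indep_vars_subset[OF ind], of Inr UNIV] by simp
  have l: "\<xi> (Inl i) \<omega> = a (X i \<omega>)" and r: "\<xi> (Inr i) \<omega> = b (Y i \<omega>)" for i \<omega> by (simp_all add: \<xi>_def)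
  have rva [measurable]: "random_variable borel (\<lambda>\<omega>. a (X i \<omega>))" "random_variable borel (\<lambda>\<omega>. b (Y i \<omega>))" for i
    using rv[of "Inl i"] rv[of "Inr i"] by (simp_all add: \<xi>_def[abs_def])
  have eq: "char (distr M borel (\<lambda>\<omega>. \<alpha> * ((\<Sum>i<n. a (X i \<omega>)) / sqrt (real n)) +
            \<beta> * ((\<Sum>j<m. b (Y j \<omega>)) / sqrt (real m)))) t =
      char (distr M borel (\<lambda>\<omega>. (\<Sum>i<n. a (X i \<omega>)) / sqrt (real n))) (\<alpha> * t) *
      char (distr M borel (\<lambda>\<omega>. (\<Sum>j<m. b (Y j \<omega>)) / sqrt (real m))) (\<beta> * t)" for n m
    using char_two_sample_sum[OF ind\<xi>, of "\<alpha> / sqrt (real n)" n "\<beta> / sqrt (real m)" m t]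
      char_distr_mult[of "\<lambda>\<omega>. \<Sum>i<n. a (X i \<omega>)" "1 / sqrt (real n)" "\<alpha> * t"]
      char_distr_mult[of "\<lambda>\<omega>. \<Sum>j<m. b (Y j \<omega>)" "1 / sqrt (real m)" "\<beta> * t"]
    by (simp add: l r)
  let ?vP = "\<integral>x. (a x)\<^sup>2 \<partial>P" and ?vQ = "\<integral>x. (b x)\<^sup>2 \<partial>Q"
  have "(\<lambda>l. char (distr M borel (\<lambda>\<omega>. (\<Sum>i<n l. a (X i \<omega>)) / sqrt (real (n l)))) (\<alpha> * t) *
      char (distr M borel (\<lambda>\<omega>. (\<Sum>j<m l. b (Y j \<omega>)) / sqrt (real (m l)))) (\<beta> * t))
     \<longlonglongrightarrow> complex_of_real (exp (- (?vP * (\<alpha> * t)\<^sup>2 / 2))) * complex_of_real (exp (- (?vQ * (\<beta> * t)\<^sup>2 / 2)))"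
    by (intro tendsto_mult filterlim_compose[OF char_iid_sum_tendsto[OF indX X a] n]
        filterlim_compose[OF char_iid_sum_tendsto[OF indY Y b] m])
  also have "complex_of_real (exp (- (?vP * (\<alpha> * t)\<^sup>2 / 2))) * complex_of_real (exp (- (?vQ * (\<beta> * t)\<^sup>2 / 2)))
      = char (normal_law 0 (\<alpha>\<^sup>2 * ?vP + \<beta>\<^sup>2 * ?vQ)) t"
    by (subst char_normal_law)
      (auto simp: power_mult_distrib algebra_simps add_divide_distrib simp flip: of_real_mult exp_add
        intro!: add_nonneg_nonneg mult_nonneg_nonneg)
  finally show ?thesis unfolding eq .
qed

end


section \<open>Asymptotic normality of the test statistic\<close>

text \<open>By the reproducing property. It turns the hypothesis on \<open>k x x\<close> into a fourth moment of the kernel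
  section.\<close>
lemma norm_kernel_section:
  fixes fn :: "'h::{real_inner, banach} \<Rightarrow> 'a \<Rightarrow> real"
  assumes "is_rkhs k fn"
  shows "(norm (kernel_section k fn x))\<^sup>2 = k x x"
proof -
  obtain h where h: "fn h = (\<lambda>y. k y x)" "\<And>f. f \<bullet> h = fn f x"
    using assms unfolding is_rkhs_def by blast
  have "kernel_section k fn x = h"
    using assms unfolding is_rkhs_def kernel_section_def h(1)[symmetric] by (simp add: inv_f_f)
  then show ?thesis by (simp add: power2_norm_eq_inner h)
qed

theorem theorem2:
  fixes A :: "'a::{real_inner, banach, second_countable_topology} measure"
    and k :: "'a \<Rightarrow> 'a \<Rightarrow> real"
    and fn :: "'h::{real_inner, banach, second_countable_topology} \<Rightarrow> 'a \<Rightarrow> real"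
    and P Q :: "'a measure"
    and M :: "'w measure"
    and X Y :: "nat \<Rightarrow> 'w \<Rightarrow> 'a"
    and n m :: "nat \<Rightarrow> nat"
    and \<rho> :: real
  assumes "space A = UNIV"
    and "pd_kernel k"
    and "is_rkhs k fn"
    and "kernel_section k fn \<in> borel_measurable A"
    and "characteristic_kernel A k fn"
    and "prob_space P" and "sets P = sets A"
    and "prob_space Q" and "sets Q = sets A"
    and "integrable P (\<lambda>x. (k x x)\<^sup>2)"
    and "integrable Q (\<lambda>y. (k y y)\<^sup>2)"
    and "prob_space M"
    and "prob_space.indep_vars M (\<lambda>_. A) (case_sum X Y) UNIV"
    and "\<And>i. distr M A (X i) = P"
    and "\<And>j. distr M A (Y j) = Q"
    and "filterlim n at_top sequentially"
    and "filterlim m at_top sequentially"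
    and "(\<lambda>l. real (n l) / real (n l + m l)) \<longlonglongrightarrow> \<rho>"
    and "0 < \<rho>" and "\<rho> < 1"
    and "P \<noteq> Q"
  shows "weak_conv_m
    (\<lambda>l. distr M borel
       (\<lambda>\<omega>. sqrt (real (n l + m l)) *
          (test_statistic k fn (n l) (m l) (\<lambda>i. X i \<omega>) (\<lambda>j. Y j \<omega>) - cov_discrepancy k fn P Q)))
    (normal_law 0
       (4 / \<rho> * projected_variance k fn (kernel_cov k fn P - kernel_cov k fn Q) P +
        4 / (1 - \<rho>) * projected_variance k fn (kernel_cov k fn P - kernel_cov k fn Q) Q))"
proof -
  interpret P: prob_space P by fact
  interpret Q: prob_space Q by fact
  interpret M: prob_space M by fact
  let ?\<phi> = "kernel_section k fn"
  let ?SP = "kernel_cov k fn P" and ?SQ = "kernel_cov k fn Q"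
  let ?D = "?SP - ?SQ"
  define ZP where "ZP x = ?\<phi> x - kernel_mean k fn P" for x
  define ZQ where "ZQ x = ?\<phi> x - kernel_mean k fn Q" for x
  define UP where "UP x = tensor_square (ZP x) - ?SP" for x
  define UQ where "UQ x = tensor_square (ZQ x) - ?SQ" for x
  have mP: "measurable P B = measurable A B" and mQ: "measurable Q B = measurable A B" for B :: "'z measure"
    using \<open>sets P = sets A\<close> \<open>sets Q = sets A\<close> by (auto intro!: measurable_cong_sets)
  note [measurable] = \<open>?\<phi> \<in> borel_measurable A\<close>
  have pow4: "norm (?\<phi> x) ^ 4 = (k x x)\<^sup>2" for x
    using norm_kernel_section[OF \<open>is_rkhs k fn\<close>, of x] by (simp flip: power2_power2)
  have meas [measurable]: "ZP \<in> borel_measurable A" "ZQ \<in> borel_measurable A"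
    "UP \<in> borel_measurable A" "UQ \<in> borel_measurable A"
    unfolding ZP_def UP_def ZQ_def UQ_def by measurable
  have momP: "integrable P (\<lambda>x. (norm (ZP x))\<^sup>2)" "(\<integral>x. ZP x \<partial>P) = 0"
    "integrable P (\<lambda>x. (norm (UP x))\<^sup>2)" "(\<integral>x. UP x \<partial>P) = 0"
    using P.centered_tensor_square_moments[of ?\<phi>] \<open>integrable P (\<lambda>x. (k x x)\<^sup>2)\<close>
    by (simp_all add: mP pow4 ZP_def UP_def kernel_cov_def kernel_mean_def)
  have momQ: "integrable Q (\<lambda>x. (norm (ZQ x))\<^sup>2)" "(\<integral>x. ZQ x \<partial>Q) = 0"
    "integrable Q (\<lambda>x. (norm (UQ x))\<^sup>2)" "(\<integral>x. UQ x \<partial>Q) = 0"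
    using Q.centered_tensor_square_moments[of ?\<phi>] \<open>integrable Q (\<lambda>x. (k x x)\<^sup>2)\<close>
    by (simp_all add: mQ pow4 ZQ_def UQ_def kernel_cov_def kernel_mean_def)

  define a where "a x = ?D \<bullet> UP x" for x
  define b where "b x = ?D \<bullet> UQ x" for x
  have ab [measurable]: "a \<in> borel_measurable A" "b \<in> borel_measurable A"
    unfolding a_def b_def by measurable
  have CS: "(?D \<bullet> u)\<^sup>2 \<le> (norm ?D)\<^sup>2 * (norm u)\<^sup>2" for u
    using Cauchy_Schwarz_ineq[of ?D u] by (simp add: power2_norm_eq_inner)
  have a2: "integrable P (\<lambda>x. (a x)\<^sup>2)"
    by (rule Bochner_Integration.integrable_bound[OF integrable_mult_right[OF momP(3), of "(norm ?D)\<^sup>2"]])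
      (auto simp: a_def CS mP)
  have b2: "integrable Q (\<lambda>x. (b x)\<^sup>2)"
    by (rule Bochner_Integration.integrable_bound[OF integrable_mult_right[OF momQ(3), of "(norm ?D)\<^sup>2"]])
      (auto simp: b_def CS mQ)
  have UPi: "integrable P UP" by (rule P.integrable_of_norm_square[OF _ momP(3)]) (simp add: mP)
  have UQi: "integrable Q UQ" by (rule Q.integrable_of_norm_square[OF _ momQ(3)]) (simp add: mQ)
  have a0: "(\<integral>x. a x \<partial>P) = 0" and b0: "(\<integral>x. b x \<partial>Q) = 0"
    unfolding a_def b_def using UPi UQi momP(4) momQ(4) by simp_all
  have vP: "projected_variance k fn ?D P = (\<integral>x. (a x)\<^sup>2 \<partial>P)"
    and vQ: "projected_variance k fn ?D Q = (\<integral>x. (b x)\<^sup>2 \<partial>Q)"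
    using a0 b0 unfolding projected_variance_def a_def b_def UP_def UQ_def ZP_def ZQ_def by simp_all

  have ind: "M.indep_vars (\<lambda>_. A) (case_sum X Y) UNIV" by fact
  have indX: "M.indep_vars (\<lambda>_. A) X UNIV"
    using M.indep_vars_reindex[OF M.indep_vars_subset[OF ind], of Inl UNIV] by simp
  have indY: "M.indep_vars (\<lambda>_. A) Y UNIV"
    using M.indep_vars_reindex[OF M.indep_vars_subset[OF ind], of Inr UNIV] by simp
  have XY [measurable]: "X i \<in> measurable M A" "Y i \<in> measurable M A" for i
    using indX indY unfolding M.indep_vars_def2 by auto
  note lawX = \<open>\<And>i. distr M A (X i) = P\<close> and lawY = \<open>\<And>j. distr M A (Y j) = Q\<close>

  define N where "N l = real (n l + m l)" for l
  define T where "T l \<omega> = sqrt (N l) *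
    (test_statistic k fn (n l) (m l) (\<lambda>i. X i \<omega>) (\<lambda>j. Y j \<omega>) - cov_discrepancy k fn P Q)" for l \<omega>
  define zP where "zP l \<omega> = (1 / real (n l)) *\<^sub>R (\<Sum>i<n l. ZP (X i \<omega>))" for l \<omega>
  define zQ where "zQ l \<omega> = (1 / real (m l)) *\<^sub>R (\<Sum>i<m l. ZQ (Y i \<omega>))" for l \<omega>
  define uP where "uP l \<omega> = (1 / real (n l)) *\<^sub>R (\<Sum>i<n l. UP (X i \<omega>))" for l \<omega>
  define uQ where "uQ l \<omega> = (1 / real (m l)) *\<^sub>R (\<Sum>i<m l. UQ (Y i \<omega>))" for l \<omega>
  define G where "G l \<omega> = (\<Sum>i<n l. a (X i \<omega>)) / sqrt (real (n l))" for l \<omega>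
  define H where "H l \<omega> = (\<Sum>j<m l. b (Y j \<omega>)) / sqrt (real (m l))" for l \<omega>
  \<comment> \<open>\<open>G\<close> and \<open>H\<close> enter the statistic with the weights \<open>c l\<close> and \<open>d l\<close>, which converge to \<open>\<alpha>\<close> and \<open>\<beta>\<close>.\<close>
  define \<alpha> where "\<alpha> = 2 / sqrt \<rho>"
  define \<beta> where "\<beta> = - 2 / sqrt (1 - \<rho>)"
  define c where "c l = 2 * sqrt (N l) / sqrt (real (n l))" for l
  define d where "d l = - 2 * sqrt (N l) / sqrt (real (m l))" for l
  define K where "K = 2 * norm ?D + 4"
  define W where "W l \<omega> = (norm (uP l \<omega>))\<^sup>2 + (norm (uQ l \<omega>))\<^sup>2 + (norm (zP l \<omega>))\<^sup>2 + (norm (zQ l \<omega>))\<^sup>2" for l \<omega>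
  \<comment> \<open>\<open>C\<close> and \<open>C'\<close> are the numerators of the mean squares that \<open>W\<close> collects from the two samples.\<close>
  define C where "C = (\<integral>x. (norm (UP x))\<^sup>2 \<partial>P) + (\<integral>x. (norm (ZP x))\<^sup>2 \<partial>P)"
  define C' where "C' = (\<integral>x. (norm (UQ x))\<^sup>2 \<partial>Q) + (\<integral>x. (norm (ZQ x))\<^sup>2 \<partial>Q)"
  have measT [measurable]: "T l \<in> borel_measurable M" for l
    unfolding T_def test_statistic_def sample_cov_def sample_mean_def by measurable
  have measGH [measurable]: "G l \<in> borel_measurable M" "H l \<in> borel_measurable M" for l
    unfolding G_def H_def by measurable

  \<comment> \<open>An empty sample, possible for small \<open>l\<close>, has the average \<open>0\<close> by default, and then \<open>sample_cov_decomposition\<close> may fail.\<close>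
  have ev: "\<forall>\<^sub>F l in sequentially. n l > 0 \<and> m l > 0"
    by (intro eventually_conj eventually_compose_filterlim[OF eventually_gt_at_top]) fact+

  have intW: "integrable M (W l)"
    and EW: "M.expectation (W l) = C / real (n l) + C' / real (m l)" for l
    using M.iid_sample_mean[OF indX lawX meas(1) momP(1,2)] M.iid_sample_mean[OF indX lawX meas(3) momP(3,4)]
      M.iid_sample_mean[OF indY lawY meas(2) momQ(1,2)] M.iid_sample_mean[OF indY lawY meas(4) momQ(3,4)]
    unfolding W_def zP_def zQ_def uP_def uQ_def C_def C'_def by (simp_all add: add_divide_distrib)
  have G2: "integrable M (\<lambda>\<omega>. (G l \<omega>)\<^sup>2)" "M.expectation (\<lambda>\<omega>. (G l \<omega>)\<^sup>2) = (\<integral>x. (a x)\<^sup>2 \<partial>P)"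
    if "n l > 0" for l
  proof -
    have "(G l \<omega>)\<^sup>2 = real (n l) * (norm ((1 / real (n l)) *\<^sub>R (\<Sum>i<n l. a (X i \<omega>))))\<^sup>2" for \<omega>
      using that by (simp add: G_def power_divide power2_eq_square)
    then show "integrable M (\<lambda>\<omega>. (G l \<omega>)\<^sup>2)" "M.expectation (\<lambda>\<omega>. (G l \<omega>)\<^sup>2) = (\<integral>x. (a x)\<^sup>2 \<partial>P)"
      using M.iid_sample_mean[OF indX lawX ab(1) _ a0, of "n l"] a2 that by (simp_all del: norm_scaleR)
  qed
  have H2: "integrable M (\<lambda>\<omega>. (H l \<omega>)\<^sup>2)" "M.expectation (\<lambda>\<omega>. (H l \<omega>)\<^sup>2) = (\<integral>x. (b x)\<^sup>2 \<partial>Q)"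
    if "m l > 0" for l
  proof -
    have "(H l \<omega>)\<^sup>2 = real (m l) * (norm ((1 / real (m l)) *\<^sub>R (\<Sum>i<m l. b (Y i \<omega>))))\<^sup>2" for \<omega>
      using that by (simp add: H_def power_divide power2_eq_square)
    then show "integrable M (\<lambda>\<omega>. (H l \<omega>)\<^sup>2)" "M.expectation (\<lambda>\<omega>. (H l \<omega>)\<^sup>2) = (\<integral>x. (b x)\<^sup>2 \<partial>Q)"
      using M.iid_sample_mean[OF indY lawY ab(2) _ b0, of "m l"] b2 that by (simp_all del: norm_scaleR)
  qed

  \<comment> \<open>The statistic is compared with a linear combination whose weights no longer depend on \<open>l\<close>; this
    replacement costs the last two terms.\<close>
  have pointwise: "min 1 \<bar>T l \<omega> - (\<alpha> * G l \<omega> + \<beta> * H l \<omega>)\<bar> \<le>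
      K * (sqrt (N l) * W l \<omega>) + \<bar>c l - \<alpha>\<bar> * (1 + (G l \<omega>)\<^sup>2) + \<bar>d l - \<beta>\<bar> * (1 + (H l \<omega>)\<^sup>2)"
    if pos: "n l > 0" "m l > 0" for l \<omega>
  proof -
    define R where "R = (norm (?D + (uP l \<omega> - tensor_square (zP l \<omega>)) - (uQ l \<omega> - tensor_square (zQ l \<omega>))))\<^sup>2
      - (norm ?D)\<^sup>2 - 2 * (?D \<bullet> uP l \<omega> - ?D \<bullet> uQ l \<omega>)"
    have "sample_cov k fn (n l) (\<lambda>i. X i \<omega>) = ?SP + uP l \<omega> - tensor_square (zP l \<omega>)"
      unfolding uP_def zP_def UP_def ZP_def by (rule sample_cov_decomposition[OF pos(1)])
    moreover have "sample_cov k fn (m l) (\<lambda>j. Y j \<omega>) = ?SQ + uQ l \<omega> - tensor_square (zQ l \<omega>)"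
      unfolding uQ_def zQ_def UQ_def ZQ_def by (rule sample_cov_decomposition[OF pos(2)])
    ultimately have "sample_cov k fn (n l) (\<lambda>i. X i \<omega>) - sample_cov k fn (m l) (\<lambda>j. Y j \<omega>) =
        ?D + (uP l \<omega> - tensor_square (zP l \<omega>)) - (uQ l \<omega> - tensor_square (zQ l \<omega>))"
      by simp
    then have T: "T l \<omega> = sqrt (N l) * R + sqrt (N l) * (2 * (?D \<bullet> uP l \<omega> - ?D \<bullet> uQ l \<omega>))"
      by (simp add: T_def test_statistic_def cov_discrepancy_def R_def flip: distrib_left)
    have DuP: "?D \<bullet> uP l \<omega> = G l \<omega> / sqrt (real (n l))"
      using pos by (simp add: uP_def G_def a_def inner_sum_right)
    have DuQ: "?D \<bullet> uQ l \<omega> = H l \<omega> / sqrt (real (m l))"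
      using pos by (simp add: uQ_def H_def b_def inner_sum_right)
    have lin: "sqrt (N l) * (2 * (?D \<bullet> uP l \<omega> - ?D \<bullet> uQ l \<omega>)) = c l * G l \<omega> + d l * H l \<omega>"
      unfolding DuP DuQ c_def d_def by (simp add: algebra_simps)
    have "T l \<omega> - (\<alpha> * G l \<omega> + \<beta> * H l \<omega>) =
        sqrt (N l) * R + ((c l - \<alpha>) * G l \<omega> + (d l - \<beta>) * H l \<omega>)"
      unfolding T lin by (simp add: algebra_simps)
    moreover have "min 1 \<bar>r + (g + h)\<bar> \<le> min 1 \<bar>r\<bar> + \<bar>g\<bar> + \<bar>h\<bar>" for r g h :: real
      using abs_triangle_ineq[of r "g + h"] abs_triangle_ineq[of g h] abs_ge_zero[of g] abs_ge_zero[of h]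
      by (auto simp: min_def simp del: abs_ge_zero)
    ultimately have "min 1 \<bar>T l \<omega> - (\<alpha> * G l \<omega> + \<beta> * H l \<omega>)\<bar> \<le>
        min 1 \<bar>sqrt (N l) * R\<bar> + \<bar>(c l - \<alpha>) * G l \<omega>\<bar> + \<bar>(d l - \<beta>) * H l \<omega>\<bar>"
      by simp
    moreover have "min 1 \<bar>sqrt (N l) * R\<bar> \<le> K * (sqrt (N l) * W l \<omega>)"
      unfolding R_def K_def W_def
      by (rule norm_square_expansion_remainder)
        (use pos norm_tensor_le[of "zP l \<omega>" "zP l \<omega>"] norm_tensor_le[of "zQ l \<omega>" "zQ l \<omega>"]
          in \<open>auto simp: N_def power2_eq_square\<close>)
    \<comment> \<open>Trading \<open>\<bar>y\<bar>\<close> for a square leaves only second moments to be computed.\<close>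
    moreover have abs_le: "\<bar>y\<bar> \<le> 1 + y\<^sup>2" for y :: real
      using zero_le_power2[of "\<bar>y\<bar> - 1"] zero_le_power2[of y] by (simp add: power2_diff)
    have "\<bar>(c l - \<alpha>) * G l \<omega>\<bar> \<le> \<bar>c l - \<alpha>\<bar> * (1 + (G l \<omega>)\<^sup>2)"
      "\<bar>(d l - \<beta>) * H l \<omega>\<bar> \<le> \<bar>d l - \<beta>\<bar> * (1 + (H l \<omega>)\<^sup>2)"
      unfolding abs_mult by (intro mult_left_mono abs_le; simp)+
    ultimately show ?thesis by linarith
  qed

  have expect: "M.expectation (\<lambda>\<omega>. min 1 \<bar>T l \<omega> - (\<alpha> * G l \<omega> + \<beta> * H l \<omega>)\<bar>) \<le>
      K * (C * (sqrt (N l) / real (n l)) + C' * (sqrt (N l) / real (m l)))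
      + \<bar>c l - \<alpha>\<bar> * (1 + (\<integral>x. (a x)\<^sup>2 \<partial>P)) + \<bar>d l - \<beta>\<bar> * (1 + (\<integral>x. (b x)\<^sup>2 \<partial>Q))"
    if pos: "n l > 0" "m l > 0" for l
  proof -
    have "M.expectation (\<lambda>\<omega>. min 1 \<bar>T l \<omega> - (\<alpha> * G l \<omega> + \<beta> * H l \<omega>)\<bar>) \<le>
      M.expectation (\<lambda>\<omega>. K * (sqrt (N l) * W l \<omega>) + \<bar>c l - \<alpha>\<bar> * (1 + (G l \<omega>)\<^sup>2) + \<bar>d l - \<beta>\<bar> * (1 + (H l \<omega>)\<^sup>2))"
    proof (rule integral_mono)
      show "integrable M (\<lambda>\<omega>. min 1 \<bar>T l \<omega> - (\<alpha> * G l \<omega> + \<beta> * H l \<omega>)\<bar>)"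
        by (rule M.integrable_const_bound[of _ 1]) auto
    qed (use pointwise[OF pos] intW G2[OF pos(1)] H2[OF pos(2)] in auto)
    also have "\<dots> = K * (sqrt (N l) * (C / real (n l) + C' / real (m l)))
      + \<bar>c l - \<alpha>\<bar> * (1 + (\<integral>x. (a x)\<^sup>2 \<partial>P)) + \<bar>d l - \<beta>\<bar> * (1 + (\<integral>x. (b x)\<^sup>2 \<partial>Q))"
      using intW EW G2[OF pos(1)] H2[OF pos(2)] by (simp add: M.prob_space)
    finally show ?thesis by (simp add: algebra_simps)
  qed

  have fracP: "(\<lambda>l. real (n l) / N l) \<longlonglongrightarrow> \<rho>"
    using \<open>(\<lambda>l. real (n l) / real (n l + m l)) \<longlonglongrightarrow> \<rho>\<close> unfolding N_def .
  have "(\<lambda>l. 1 - real (n l) / N l) \<longlonglongrightarrow> 1 - \<rho>" by (intro tendsto_intros fracP)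
  moreover have "\<forall>\<^sub>F l in sequentially. 1 - real (n l) / N l = real (m l) / N l"
    using ev by eventually_elim (auto simp: N_def field_simps)
  ultimately have fracQ: "(\<lambda>l. real (m l) / N l) \<longlonglongrightarrow> 1 - \<rho>" by (simp cong: tendsto_cong)
  have "filterlim (\<lambda>l. n l + m l) at_top sequentially"
    using \<open>filterlim n at_top sequentially\<close> by (rule filterlim_at_top_mono) auto
  then have "filterlim N at_top sequentially"
    unfolding N_def by (rule filterlim_compose[OF filterlim_real_sequentially])
  then have "filterlim (\<lambda>l. sqrt (N l)) at_top sequentially" by (rule filterlim_compose[OF sqrt_at_top])
  then have Ninv: "(\<lambda>l. inverse (sqrt (N l))) \<longlonglongrightarrow> 0" by (rule tendsto_inverse_0_at_top)
  \<comment> \<open>\<open>sqrt N / r = (1 / sqrt N) / (r / N)\<close>, so the remainder vanishes at the rate \<open>1 / sqrt N\<close>.\<close>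
  have rate: "(\<lambda>l. sqrt (N l) / real (r l)) \<longlonglongrightarrow> 0" and weight: "(\<lambda>l. sqrt (N l) / sqrt (real (r l))) \<longlonglongrightarrow> 1 / sqrt \<sigma>"
    if fr: "(\<lambda>l. real (r l) / N l) \<longlonglongrightarrow> \<sigma>" and \<sigma>: "0 < \<sigma>" for r \<sigma>
  proof -
    have "(\<lambda>l. inverse (sqrt (N l)) * inverse (real (r l) / N l)) \<longlonglongrightarrow> 0 * inverse \<sigma>"
      by (intro tendsto_intros Ninv fr) (use \<sigma> in simp)
    moreover have "inverse (sqrt (N l)) * inverse (real (r l) / N l) = sqrt (N l) / real (r l)" for l
      by (simp add: N_def divide_simps flip: real_sqrt_mult)
    ultimately show "(\<lambda>l. sqrt (N l) / real (r l)) \<longlonglongrightarrow> 0" by (simp only: mult_zero_left)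
    have "(\<lambda>l. inverse (sqrt (real (r l) / N l))) \<longlonglongrightarrow> inverse (sqrt \<sigma>)"
      by (intro tendsto_intros fr) (use \<sigma> in simp)
    then show "(\<lambda>l. sqrt (N l) / sqrt (real (r l))) \<longlonglongrightarrow> 1 / sqrt \<sigma>"
      by (simp add: real_sqrt_divide inverse_eq_divide)
  qed
  have \<rho>: "0 < \<rho>" "0 < 1 - \<rho>" using \<open>0 < \<rho>\<close> \<open>\<rho> < 1\<close> by auto
  have "c \<longlonglongrightarrow> \<alpha>"
    using tendsto_mult_left[OF weight[OF fracP \<rho>(1)], of 2] by (simp add: c_def[abs_def] \<alpha>_def)
  then have c0: "(\<lambda>l. \<bar>c l - \<alpha>\<bar>) \<longlonglongrightarrow> 0"
    by (intro tendsto_rabs_zero LIM_zero)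
  have "d \<longlonglongrightarrow> \<beta>"
    using tendsto_mult_left[OF weight[OF fracQ \<rho>(2)], of "- 2"] by (simp add: d_def[abs_def] \<beta>_def)
  then have d0: "(\<lambda>l. \<bar>d l - \<beta>\<bar>) \<longlonglongrightarrow> 0"
    by (intro tendsto_rabs_zero LIM_zero)
  have small: "(\<lambda>l. M.expectation (\<lambda>\<omega>. min 1 \<bar>T l \<omega> - (\<alpha> * G l \<omega> + \<beta> * H l \<omega>)\<bar>)) \<longlonglongrightarrow> 0"
  proof (rule tendsto_sandwich)
    show "\<forall>\<^sub>F l in sequentially. 0 \<le> M.expectation (\<lambda>\<omega>. min 1 \<bar>T l \<omega> - (\<alpha> * G l \<omega> + \<beta> * H l \<omega>)\<bar>)"
      by (intro always_eventually allI Bochner_Integration.integral_nonneg) auto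
    show "\<forall>\<^sub>F l in sequentially. M.expectation (\<lambda>\<omega>. min 1 \<bar>T l \<omega> - (\<alpha> * G l \<omega> + \<beta> * H l \<omega>)\<bar>) \<le>
      K * (C * (sqrt (N l) / real (n l)) + C' * (sqrt (N l) / real (m l)))
      + \<bar>c l - \<alpha>\<bar> * (1 + (\<integral>x. (a x)\<^sup>2 \<partial>P)) + \<bar>d l - \<beta>\<bar> * (1 + (\<integral>x. (b x)\<^sup>2 \<partial>Q))"
      using ev by eventually_elim (use expect in blast)
    show "(\<lambda>l. K * (C * (sqrt (N l) / real (n l)) + C' * (sqrt (N l) / real (m l)))
      + \<bar>c l - \<alpha>\<bar> * (1 + (\<integral>x. (a x)\<^sup>2 \<partial>P)) + \<bar>d l - \<beta>\<bar> * (1 + (\<integral>x. (b x)\<^sup>2 \<partial>Q))) \<longlonglongrightarrow> 0"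
      by (rule tendsto_eq_intros rate[OF fracP \<rho>(1)] rate[OF fracQ \<rho>(2)] c0 d0 refl | simp)+
  qed simp

  have var: "4 / \<rho> * projected_variance k fn ?D P + 4 / (1 - \<rho>) * projected_variance k fn ?D Q =
      \<alpha>\<^sup>2 * (\<integral>x. (a x)\<^sup>2 \<partial>P) + \<beta>\<^sup>2 * (\<integral>x. (b x)\<^sup>2 \<partial>Q)"
    using \<rho> by (simp add: vP vQ \<alpha>_def \<beta>_def power_divide)
  show ?thesis
    unfolding var N_def[symmetric] T_def[symmetric]
  proof (rule M.weak_conv_m_of_char_perturbation[where g = "\<lambda>l \<omega>. \<alpha> * G l \<omega> + \<beta> * H l \<omega>"])
    show "real_distribution (normal_law 0 (\<alpha>\<^sup>2 * (\<integral>x. (a x)\<^sup>2 \<partial>P) + \<beta>\<^sup>2 * (\<integral>x. (b x)\<^sup>2 \<partial>Q)))"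
      by (intro real_distribution_normal_law add_nonneg_nonneg mult_nonneg_nonneg
          Bochner_Integration.integral_nonneg) auto
    show "(\<lambda>l. char (distr M borel (\<lambda>\<omega>. \<alpha> * G l \<omega> + \<beta> * H l \<omega>)) t) \<longlonglongrightarrow>
        char (normal_law 0 (\<alpha>\<^sup>2 * (\<integral>x. (a x)\<^sup>2 \<partial>P) + \<beta>\<^sup>2 * (\<integral>x. (b x)\<^sup>2 \<partial>Q))) t" for t
      unfolding G_def H_def
      by (rule M.char_two_sample_tendsto[OF ind lawX lawY ab(1) a2 a0 ab(2) b2 b0]) fact+
  qed (use small in auto)
qed

end
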